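(* Let $\Omega\subset\mathbb{R}^n$ ($n\ge 1$) be a bounded domain with smooth boundary $\partial\Omega$ and unit exterior normal $\nu$. Let $f,g:[0,\infty)\to[0,\infty)$ and $\alpha,\beta:[0,\infty)\to[0,\infty)$ be continuous, and let $u_0\in C^1(\overline\Omega)$, $u_0\ge 0$ in $\overline\Omega$, satisfy $\partial u_0/\partial\nu=\beta(0)g(u_0)$ on $\partial\Omega$. Suppose that $f(s)>0$ for $s>0$, $$\int^{+\infty}\frac{ds}{f(s)}<+\infty \qquad\text{and}\qquad \int_0^{+\infty}\alpha(t)\,dt=+\infty .$$ Then any nontrivial nonnegative solution of the problem $$u_t=\Delta u+\alpha(t)f(u)\ \text{ for } x\in\Omega,\ t>0,$$ $$\frac{\partial u(x,t)}{\partial\nu}=\beta(t)g(u)\ \text{ for } x\in\partial\Omega,\ t>0,$$ $$u(x,0)=u_0(x)\ \text{ for } x\in\Omega,$$ blows up in finite time.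
   Context: The notation $\int^{+\infty} ds/f(s)<+\infty$ means that $\int_a^{+\infty} ds/f(s)<+\infty$ for some (equivalently, every) $a>0$. For $T>0$ put $Q_T=\Omega\times(0,T)$, $S_T=\partial\Omega\times(0,T)$, $\Gamma_T=S_T\cup(\overline\Omega\times\{0\})$. Solutions are nonnegative classical solutions: a solution in $Q_T$ is a nonnegative function $u\in C^{2,1}(Q_T)\cap C^{1,0}(Q_T\cup\Gamma_T)$ satisfying the equation in $Q_T$, the boundary condition on $S_T$ and the initial condition. "Nontrivial" means that $u$ is not identically zero (the initial datum $u_0$ itself is allowed to be identically zero). "Any nontrivial nonnegative solution blows up in finite time" means that there is no nontrivial nonnegative classical solution that exists in $Q_T$ for every $T>0$ (i.e. on $\Omega\times(0,\infty)$). *)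

theory Defs
  imports "HOL-Analysis.Analysis"
begin

definition partial :: "'a::euclidean_space \<Rightarrow> ('a \<Rightarrow> real) \<Rightarrow> 'a \<Rightarrow> real" where
  "partial b f x = frechet_derivative f (at x) b"

definition grad :: "('a::euclidean_space \<Rightarrow> real) \<Rightarrow> 'a \<Rightarrow> 'a" where
  "grad f x = (\<Sum>b\<in>Basis. partial b f x *\<^sub>R b)"

definition laplacian :: "('a::euclidean_space \<Rightarrow> real) \<Rightarrow> 'a \<Rightarrow> real" where
  "laplacian f x = (\<Sum>b\<in>Basis. partial b (partial b f) x)"

lemma grad_eqI:
  assumes "GDERIV f x :> D"
  shows "grad f x = D"
proof -
  have "frechet_derivative f (at x) = (\<lambda>h. inner h D)"
    using assms by (simp add: gderiv_def frechet_derivative_at[symmetric])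
  then show ?thesis
    by (simp add: grad_def partial_def inner_commute[of _ D] euclidean_representation)
qed

text \<open>Meant for open \<open>S\<close> only: all derivatives are taken in the ambient space.\<close>

fun Ck_on :: "nat \<Rightarrow> 'a::euclidean_space set \<Rightarrow> ('a \<Rightarrow> real) \<Rightarrow> bool" where
  "Ck_on 0 S f \<longleftrightarrow> continuous_on S f"
| "Ck_on (Suc k) S f \<longleftrightarrow>
     (\<forall>x\<in>S. f differentiable (at x)) \<and> (\<forall>b\<in>Basis. Ck_on k S (partial b f))"

definition smooth_on :: "'a::euclidean_space set \<Rightarrow> ('a \<Rightarrow> real) \<Rightarrow> bool" where
  "smooth_on S f \<longleftrightarrow> (\<forall>k. Ck_on k S f)"

definition bounded_domain :: "'a::euclidean_space set \<Rightarrow> bool" where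
  "bounded_domain \<Omega> \<longleftrightarrow> open \<Omega> \<and> connected \<Omega> \<and> \<Omega> \<noteq> {} \<and> bounded \<Omega>"

text \<open>Near a boundary point a smooth domain is a strict sublevel set \<open>{\<rho> < 0}\<close> of a smooth
  function without critical points; by the implicit function theorem this says that it lies
  locally on one side of the graph of a smooth function. For such \<open>\<rho>\<close> the gradient is normal
  to the boundary and points out of the domain.\<close>

definition local_defining_function ::
    "'a::euclidean_space set \<Rightarrow> 'a \<Rightarrow> 'a set \<Rightarrow> ('a \<Rightarrow> real) \<Rightarrow> bool" where
  "local_defining_function \<Omega> x U \<rho> \<longleftrightarrow>
     open U \<and> x \<in> U \<and> smooth_on U \<rho> \<and> (\<forall>y\<in>U. grad \<rho> y \<noteq> 0) \<and>
     \<Omega> \<inter> U = {y\<in>U. \<rho> y < 0} \<and> frontier \<Omega> \<inter> U = {y\<in>U. \<rho> y = 0}"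

definition smooth_boundary :: "'a::euclidean_space set \<Rightarrow> bool" where
  "smooth_boundary \<Omega> \<longleftrightarrow> (\<forall>x\<in>frontier \<Omega>. \<exists>U \<rho>. local_defining_function \<Omega> x U \<rho>)"

definition unit_exterior_normal :: "'a::euclidean_space set \<Rightarrow> ('a \<Rightarrow> 'a) \<Rightarrow> bool" where
  "unit_exterior_normal \<Omega> \<nu> \<longleftrightarrow>
     (\<forall>x\<in>frontier \<Omega>. \<exists>U \<rho>. local_defining_function \<Omega> x U \<rho> \<and> \<nu> x = sgn (grad \<rho> x))"

text \<open>The functions below are only meaningful on the closure of the domain, so the derivative in
  the direction of the exterior normal is one-sided, taken from inside. For functions that are
  \<open>C\<^sup>1\<close> up to the boundary it is the inner product of the normal with the boundary value of the
  gradient.\<close>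

definition has_normal_derivative ::
    "('a::euclidean_space \<Rightarrow> real) \<Rightarrow> real \<Rightarrow> ('a \<Rightarrow> 'a) \<Rightarrow> 'a \<Rightarrow> bool" where
  "has_normal_derivative w D \<nu> x \<longleftrightarrow>
     ((\<lambda>s. w (x + s *\<^sub>R \<nu> x)) has_real_derivative D) (at_left 0)"

text \<open>Regularity up to the boundary means that the function is continuous on the closure and its
  gradient, defined in the open domain, extends continuously to the closure.\<close>

definition C1_closure :: "'a::euclidean_space set \<Rightarrow> ('a \<Rightarrow> real) \<Rightarrow> bool" where
  "C1_closure \<Omega> w \<longleftrightarrow>
     continuous_on (closure \<Omega>) w \<and>
     (\<forall>x\<in>\<Omega>. w differentiable (at x)) \<and>
     (\<exists>G. continuous_on (closure \<Omega>) G \<and> (\<forall>x\<in>\<Omega>. G x = grad w x))"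

text \<open>\<open>C\<^sup>2\<^sup>,\<^sup>1(Q\<^sub>T)\<close> with \<open>Q\<^sub>T = \<Omega> \<times> (0,T)\<close>.\<close>

definition C21_cylinder :: "'a::euclidean_space set \<Rightarrow> real \<Rightarrow> ('a \<Rightarrow> real \<Rightarrow> real) \<Rightarrow> bool" where
  "C21_cylinder \<Omega> T u \<longleftrightarrow>
     (\<forall>t\<in>{0<..<T}. Ck_on 2 \<Omega> (\<lambda>x. u x t)) \<and>
     (\<forall>x\<in>\<Omega>. \<forall>t\<in>{0<..<T}. u x differentiable (at t)) \<and>
     continuous_on (\<Omega> \<times> {0<..<T}) (\<lambda>(x, t). u x t) \<and>
     continuous_on (\<Omega> \<times> {0<..<T}) (\<lambda>(x, t). deriv (u x) t) \<and>
     (\<forall>b\<in>Basis. continuous_on (\<Omega> \<times> {0<..<T}) (\<lambda>(x, t). partial b (\<lambda>y. u y t) x)) \<and>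
     (\<forall>b\<in>Basis. \<forall>c\<in>Basis.
        continuous_on (\<Omega> \<times> {0<..<T}) (\<lambda>(x, t). partial c (partial b (\<lambda>y. u y t)) x))"

text \<open>\<open>C\<^sup>1\<^sup>,\<^sup>0(Q\<^sub>T \<union> \<Gamma>\<^sub>T)\<close>; note that \<open>Q\<^sub>T \<union> \<Gamma>\<^sub>T\<close> is the closure of \<open>\<Omega>\<close> times \<open>[0,T)\<close>.\<close>

definition C10_up_to_parabolic_boundary ::
    "'a::euclidean_space set \<Rightarrow> real \<Rightarrow> ('a \<Rightarrow> real \<Rightarrow> real) \<Rightarrow> bool" where
  "C10_up_to_parabolic_boundary \<Omega> T u \<longleftrightarrow>
     continuous_on (closure \<Omega> \<times> {0..<T}) (\<lambda>(x, t). u x t) \<and>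
     (\<forall>t\<in>{0..<T}. \<forall>x\<in>\<Omega>. (\<lambda>y. u y t) differentiable (at x)) \<and>
     (\<exists>G. continuous_on (closure \<Omega> \<times> {0..<T}) (\<lambda>(x, t). G x t) \<and>
          (\<forall>x\<in>\<Omega>. \<forall>t\<in>{0..<T}. G x t = grad (\<lambda>y. u y t) x))"

definition nonneg_classical_solution ::
    "'a::euclidean_space set \<Rightarrow> ('a \<Rightarrow> 'a) \<Rightarrow> (real \<Rightarrow> real) \<Rightarrow> (real \<Rightarrow> real) \<Rightarrow>
     (real \<Rightarrow> real) \<Rightarrow> (real \<Rightarrow> real) \<Rightarrow> ('a \<Rightarrow> real) \<Rightarrow> real \<Rightarrow> ('a \<Rightarrow> real \<Rightarrow> real) \<Rightarrow> bool" where
  "nonneg_classical_solution \<Omega> \<nu> f g \<alpha> \<beta> u\<^sub>0 T u \<longleftrightarrow>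
     C21_cylinder \<Omega> T u \<and> C10_up_to_parabolic_boundary \<Omega> T u \<and>
     (\<forall>x\<in>closure \<Omega>. \<forall>t\<in>{0..<T}. 0 \<le> u x t) \<and>
     (\<forall>x\<in>\<Omega>. \<forall>t\<in>{0<..<T}.
        deriv (u x) t = laplacian (\<lambda>y. u y t) x + \<alpha> t * f (u x t)) \<and>
     (\<forall>x\<in>frontier \<Omega>. \<forall>t\<in>{0<..<T}.
        has_normal_derivative (\<lambda>y. u y t) (\<beta> t * g (u x t)) \<nu> x) \<and>
     (\<forall>x\<in>\<Omega>. u x 0 = u\<^sub>0 x)"

end

theory Submission
  imports Defs
begin

text \<open>A nontrivial solution is a nonnegative supersolution of the heat equation, so it becomes
  positive in \<open>\<Omega>\<close> (it spreads over balls and \<open>\<Omega>\<close> is connected), and on the boundary as well: at a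
  boundary zero Hopf's lemma would make the outer normal derivative negative, whereas it equals
  \<open>\<beta> g \<ge> 0\<close>. Hence it is bounded below by a positive constant at some time. From then on it stays
  above every spatially constant strict subsolution, again because a first contact contradicts
  the equation inside and Hopf's lemma on the boundary. With \<open>G' = 1 / f\<close> and \<open>A' = \<alpha>\<close> the function
  \<open>z(t) = G\<^sup>-\<^sup>1 (G c + A t - A t\<^sub>2 - \<epsilon> (t - t\<^sub>2))\<close> is such a subsolution. As \<open>G\<close> is bounded and \<open>A\<close> is
  not, \<open>z\<close> exceeds any bound on a finite time interval, on which \<open>u\<close> is bounded. Since \<open>f\<close> need not
  be Lipschitz, the loss \<open>\<epsilon>\<close> provides the strictness that the comparison needs.\<close>

section \<open>Pointwise second-order calculus\<close>

text \<open>Differentiability on a whole neighbourhood makes the first partial derivatives genuine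
  near \<open>x\<close> and not default values of \<open>frechet_derivative\<close>; one more
  derivative at \<open>x\<close> itself then suffices for the Laplacian.\<close>

definition twice_diff_at :: "('a::euclidean_space \<Rightarrow> real) \<Rightarrow> 'a \<Rightarrow> bool" where
  "twice_diff_at w x \<longleftrightarrow>
     (\<forall>\<^sub>F y in nhds x. w differentiable at y) \<and> (\<forall>b\<in>Basis. partial b w differentiable at x)"

lemma partial_eqI:
  assumes "(w has_derivative w') (at x)"
  shows "partial b w x = w' b"
  using assms by (simp add: partial_def frechet_derivative_at[symmetric])

lemma has_derivative_partial:
  assumes "w differentiable at x"
  shows "(w has_derivative (\<lambda>h. \<Sum>b\<in>Basis. (h \<bullet> b) * partial b w x)) (at x)"
proof -
  let ?D = "frechet_derivative w (at x)"
  have D: "(w has_derivative ?D) (at x)"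
    using assms frechet_derivative_works by blast
  then interpret linear ?D by (rule has_derivative_linear)
  have "?D h = (\<Sum>b\<in>Basis. (h \<bullet> b) * partial b w x)" for h
  proof -
    have "?D h = ?D (\<Sum>b\<in>Basis. (h \<bullet> b) *\<^sub>R b)"
      by (simp add: euclidean_representation)
    also have "\<dots> = (\<Sum>b\<in>Basis. (h \<bullet> b) * partial b w x)"
      by (simp add: sum scale partial_def)
    finally show ?thesis .
  qed
  then show ?thesis using D by (metis (no_types, lifting) ext)
qed

lemma has_derivative_grad:
  assumes "w differentiable at x"
  shows "(w has_derivative (\<lambda>h. h \<bullet> grad w x)) (at x)"
  using has_derivative_partial[OF assms]
  by (simp add: grad_def inner_sum_right mult.commute)

lemma has_real_derivative_partial:
  assumes "w differentiable at (x + s *\<^sub>R b)"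
  shows "((\<lambda>s. w (x + s *\<^sub>R b)) has_real_derivative partial b w (x + s *\<^sub>R b)) (at s)"
proof -
  have D: "(w has_derivative frechet_derivative w (at (x + s *\<^sub>R b))) (at (x + s *\<^sub>R b))"
    using assms frechet_derivative_works by blast
  have "((\<lambda>s. x + s *\<^sub>R b) has_derivative (\<lambda>h. h *\<^sub>R b)) (at s)"
    by (auto intro!: derivative_eq_intros)
  from has_derivative_compose[OF this D]
  have "((\<lambda>s. w (x + s *\<^sub>R b)) has_derivative
      (\<lambda>h. frechet_derivative w (at (x + s *\<^sub>R b)) (h *\<^sub>R b))) (at s)" .
  moreover have "frechet_derivative w (at (x + s *\<^sub>R b)) (h *\<^sub>R b) = partial b w (x + s *\<^sub>R b) * h" for h
    using linear_cmul[OF has_derivative_linear[OF D]] by (simp add: partial_def)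
  ultimately show ?thesis by (simp add: has_field_derivative_def)
qed

text \<open>Derivatives depend only on the germ at \<open>x\<close>. This is what permits
  differentiating a formula for the first partial derivatives that is known only near
  \<open>x\<close>.\<close>

lemma partial_transform_eventually:
  assumes "\<forall>\<^sub>F y in nhds x. v y = w y" and "v differentiable at x"
  shows "w differentiable at x" and "partial b w x = partial b v x"
proof -
  have D: "(v has_derivative frechet_derivative v (at x)) (at x)"
    using assms(2) frechet_derivative_works by blast
  have "(w has_derivative frechet_derivative v (at x)) (at x)"
    by (rule has_derivative_transform_eventually[OF D])
      (use assms(1) eventually_nhds_x_imp_x in \<open>auto simp: eventually_at_filter elim: eventually_mono\<close>)
  then show "w differentiable at x" "partial b w x = partial b v x"
    using partial_eqI by (auto simp: differentiable_def partial_def[of _ v])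
qed

lemma partial_diff_cmult:
  assumes "v differentiable at x" "w differentiable at x"
  shows "partial b (\<lambda>y. v y - c * w y) x = partial b v x - c * partial b w x"
proof -
  have "((\<lambda>y. v y - c * w y) has_derivative
      (\<lambda>h. frechet_derivative v (at x) h - c * frechet_derivative w (at x) h)) (at x)"
    using assms[unfolded frechet_derivative_works]
    by (auto intro!: derivative_eq_intros)
  from partial_eqI[OF this] show ?thesis by (simp add: partial_def)
qed

lemma
  assumes "twice_diff_at v x" "twice_diff_at w x"
  shows twice_diff_at_diff_cmult: "twice_diff_at (\<lambda>y. v y - c * w y) x"
    and laplacian_diff_cmult:
      "laplacian (\<lambda>y. v y - c * w y) x = laplacian v x - c * laplacian w x"
proof -
  have ev: "\<forall>\<^sub>F y in nhds x. v differentiable at y \<and> w differentiable at y"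
    using assms by (auto simp: twice_diff_at_def intro: eventually_conj)
  have ev1: "\<forall>\<^sub>F y in nhds x. partial b v y - c * partial b w y = partial b (\<lambda>y. v y - c * w y) y" for b
    using ev by eventually_elim (simp add: partial_diff_cmult)
  have ev2: "\<forall>\<^sub>F y in nhds x. (\<lambda>y. v y - c * w y) differentiable at y"
    using ev by eventually_elim auto
  have p: "partial b v differentiable at x" "partial b w differentiable at x" if "b \<in> Basis" for b
    using assms that by (auto simp: twice_diff_at_def)
  have p2: "(\<lambda>y. partial b v y - c * partial b w y) differentiable at x" if "b \<in> Basis" for b
    using p[OF that] by auto
  show "twice_diff_at (\<lambda>y. v y - c * w y) x"
    unfolding twice_diff_at_def using ev2 partial_transform_eventually(1)[OF ev1 p2] by blast
  show "laplacian (\<lambda>y. v y - c * w y) x = laplacian v x - c * laplacian w x"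
    unfolding laplacian_def
    by (simp add: partial_transform_eventually(2)[OF ev1 p2] partial_diff_cmult p
        sum_subtractf sum_distrib_left)
qed

lemma twice_diff_at_if_Ck_on:
  assumes "Ck_on 2 S w" "open S" "x \<in> S"
  shows "twice_diff_at w x"
  using assms eventually_nhds_in_open[of S x]
  by (auto simp: twice_diff_at_def numeral_2_eq_2 elim!: eventually_mono)

text \<open>Both barriers below are a function \<open>F\<close> of a simpler expression. The
  gradient term with \<open>F''\<close> is what makes them strict subsolutions where the region is
  thin.\<close>

lemma
  fixes w :: "'a::euclidean_space \<Rightarrow> real"
  assumes w: "twice_diff_at w x"
    and F: "\<And>s. (F has_real_derivative F' s) (at s)"
    and F': "\<And>s. (F' has_real_derivative F'' s) (at s)"
  shows twice_diff_at_compose: "twice_diff_at (\<lambda>y. F (w y)) x"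
    and laplacian_compose:
      "laplacian (\<lambda>y. F (w y)) x = F'' (w x) * (norm (grad w x))\<^sup>2 + F' (w x) * laplacian w x"
proof -
  have D: "((\<lambda>y. F (w y)) has_derivative (\<lambda>h. F' (w y) * frechet_derivative w (at y) h)) (at y)"
    if "w differentiable at y" for y
    using has_derivative_compose[OF that[unfolded frechet_derivative_works]
        F[of "w y", unfolded has_field_derivative_def]] by simp
  have ev: "\<forall>\<^sub>F y in nhds x. w differentiable at y"
    using w by (auto simp: twice_diff_at_def)
  then have wx: "w differentiable at x" by (rule eventually_nhds_x_imp_x)
  have ev1: "\<forall>\<^sub>F y in nhds x. F' (w y) * partial b w y = partial b (\<lambda>y. F (w y)) y" for b
    using ev by eventually_elim (simp add: partial_eqI[OF D] partial_def[of _ w])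
  have ev2: "\<forall>\<^sub>F y in nhds x. (\<lambda>y. F (w y)) differentiable at y"
    using ev by eventually_elim (use D in \<open>auto simp: differentiable_def\<close>)
  have D': "((\<lambda>y. F' (w y)) has_derivative (\<lambda>h. F'' (w x) * frechet_derivative w (at x) h)) (at x)"
    using has_derivative_compose[OF wx[unfolded frechet_derivative_works]
        F'[of "w x", unfolded has_field_derivative_def]] by simp
  have p: "partial b w differentiable at x" if "b \<in> Basis" for b
    using w that by (auto simp: twice_diff_at_def)
  have D2: "((\<lambda>y. F' (w y) * partial b w y) has_derivative
      (\<lambda>h. F' (w x) * frechet_derivative (partial b w) (at x) h
        + F'' (w x) * frechet_derivative w (at x) h * partial b w x)) (at x)" if "b \<in> Basis" for b
    by (rule has_derivative_mult[OF D' p[OF that, unfolded frechet_derivative_works]])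
  have p2: "(\<lambda>y. F' (w y) * partial b w y) differentiable at x" if "b \<in> Basis" for b
    using D2[OF that] by (auto simp: differentiable_def)
  show "twice_diff_at (\<lambda>y. F (w y)) x"
    unfolding twice_diff_at_def using ev2 partial_transform_eventually(1)[OF ev1 p2] by blast
  have norm: "(norm (grad w x))\<^sup>2 = (\<Sum>b\<in>Basis. partial b w x * partial b w x)"
    unfolding power2_norm_eq_inner by (subst euclidean_inner) (simp add: grad_def)
  show "laplacian (\<lambda>y. F (w y)) x = F'' (w x) * (norm (grad w x))\<^sup>2 + F' (w x) * laplacian w x"
    unfolding laplacian_def norm
    by (simp add: partial_transform_eventually(2)[OF ev1 p2] partial_eqI[OF D2] sum.distrib
        sum_distrib_left mult.assoc flip: partial_def)
qed

text \<open>The second derivative test along each coordinate line: a negative second derivative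
  would make the first derivative, zero at the minimum, negative just to the right, so the function
  would drop below its minimum.\<close>

lemma laplacian_nonneg_at_min:
  assumes w: "twice_diff_at w x" and min: "\<forall>\<^sub>F y in nhds x. w x \<le> w y"
  shows "laplacian w x \<ge> 0"
  unfolding laplacian_def
proof (rule sum_nonneg)
  fix b :: 'a assume b: "b \<in> Basis"
  let ?h = "\<lambda>s. w (x + s *\<^sub>R b)" and ?h' = "\<lambda>s. partial b w (x + s *\<^sub>R b)"
  have "\<forall>\<^sub>F y in nhds x. w differentiable at y \<and> w x \<le> w y"
    using w min by (auto simp: twice_diff_at_def intro: eventually_conj)
  then obtain e where e: "e > 0" "\<And>y. dist y x < e \<Longrightarrow> w differentiable at y \<and> w x \<le> w y"
    unfolding eventually_nhds_metric by auto
  have h: "(?h has_real_derivative ?h' s) (at s)" "?h 0 \<le> ?h s" if "\<bar>s\<bar> < e" for s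
  proof -
    have "dist (x + s *\<^sub>R b) x < e" using that b by (simp add: dist_norm)
    then show "(?h has_real_derivative ?h' s) (at s)" "?h 0 \<le> ?h s"
      using e(2) by (auto intro: has_real_derivative_partial)
  qed
  have h'0: "?h' 0 = 0"
    by (rule DERIV_local_min[OF h(1) e(1)]) (use h(2) e(1) in auto)
  have h'': "(?h' has_real_derivative partial b (partial b w) x) (at 0)"
    using has_real_derivative_partial[of "partial b w" x 0 b] w b by (auto simp: twice_diff_at_def)
  show "partial b (partial b w) x \<ge> 0"
  proof (rule ccontr)
    assume "\<not> partial b (partial b w) x \<ge> 0"
    then obtain d where d: "d > 0" "\<And>s. 0 < s \<Longrightarrow> s < d \<Longrightarrow> ?h' s < ?h' 0"
      using DERIV_neg_dec_right[OF h''] by force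
    define s where "s = min d e / 2"
    have s: "0 < s" "s < d" "s < e" using d(1) e(1) by (auto simp: s_def)
    have "?h s < ?h 0"
    proof (rule DERIV_neg_imp_decreasing_open[OF s(1)])
      show "\<exists>y. (?h has_real_derivative y) (at r) \<and> y < 0" if "0 < r" "r < s" for r
        using h(1)[of r] d(2)[of r] that s h'0 by (intro exI[of _ "?h' r"]) auto
      show "continuous_on {0..s} ?h"
        by (rule DERIV_atLeastAtMost_imp_continuous_on)
          (rule exI, rule h(1), use s in auto)
    qed
    then show False using h(2)[of s] s by auto
  qed
qed

section \<open>Minimum and maximum principles\<close>

text \<open>Difference quotients from the left have a nonnegative numerator and a negative
  denominator. The one-sided form serves a last time as well as a normal derivative taken from
  inside.\<close>

lemma left_derivative_nonpos_at_min:
  fixes h :: "real \<Rightarrow> real"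
  assumes "(h has_real_derivative D) (at_left t)" and "\<forall>\<^sub>F s in at_left t. h t \<le> h s"
  shows "D \<le> 0"
proof (rule tendsto_upperbound)
  show "((\<lambda>s. (h s - h t) / (s - t)) \<longlongrightarrow> D) (at_left t)"
    using assms(1) by (simp add: has_field_derivative_iff)
  have lt: "\<forall>\<^sub>F s in at_left t. s < t"
    by (simp add: eventually_at_filter)
  show "\<forall>\<^sub>F s in at_left t. (h s - h t) / (s - t) \<le> 0"
    using assms(2) lt
    by eventually_elim (auto simp: divide_le_0_iff)
qed simp

text \<open>At a negative minimum over \<open>K\<close> the Laplacian is nonnegative and the time
  derivative nonpositive, against the strict inequality. The shape of \<open>K\<close> is free:
  \<open>nbhd\<close> says that a point with a negative value has room in space and towards the
  past, so it is off the parabolic boundary.\<close>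

lemma parabolic_minimum_principle:
  fixes w :: "'a::euclidean_space \<Rightarrow> real \<Rightarrow> real"
  assumes K: "compact K" and cont: "continuous_on K (\<lambda>(x, t). w x t)"
    and nbhd: "\<And>x t. (x, t) \<in> K \<Longrightarrow> w x t < 0 \<Longrightarrow>
      (\<forall>\<^sub>F y in nhds x. (y, t) \<in> K) \<and> (\<forall>\<^sub>F s in at_left t. (x, s) \<in> K)"
    and super: "\<And>x t. (x, t) \<in> K \<Longrightarrow> w x t < 0 \<Longrightarrow>
      twice_diff_at (\<lambda>y. w y t) x \<and>
      (\<exists>D. (w x has_real_derivative D) (at t) \<and> laplacian (\<lambda>y. w y t) x < D)"
    and "(x, t) \<in> K"
  shows "0 \<le> w x t"
proof (rule ccontr)
  assume neg: "\<not> 0 \<le> w x t"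
  obtain p where p: "p \<in> K" "\<And>q. q \<in> K \<Longrightarrow> (\<lambda>(x, t). w x t) p \<le> (\<lambda>(x, t). w x t) q"
    using continuous_attains_inf[OF K _ cont] assms(5) by blast
  obtain y s where ys: "p = (y, s)" by (cases p)
  have yK: "(y, s) \<in> K" and min: "\<And>z r. (z, r) \<in> K \<Longrightarrow> w y s \<le> w z r"
    using p ys by auto
  have "w y s < 0" using min[OF assms(5)] neg by simp
  from nbhd[OF yK this] super[OF yK this]
  obtain D where D: "\<forall>\<^sub>F z in nhds y. (z, s) \<in> K" "\<forall>\<^sub>F r in at_left s. (y, r) \<in> K"
    "twice_diff_at (\<lambda>z. w z s) y" "(w y has_real_derivative D) (at s)" "laplacian (\<lambda>z. w z s) y < D"
    by blast
  have "0 \<le> laplacian (\<lambda>z. w z s) y"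
    using D(1) by (intro laplacian_nonneg_at_min D(3)) (auto elim: eventually_mono intro: min)
  moreover have "D \<le> 0"
    using D(2) by (intro left_derivative_nonpos_at_min[OF has_field_derivative_at_within[OF D(4)]]) (auto elim: eventually_mono intro: min)
  ultimately show False using D(5) by simp
qed


definition supersol_at :: "('a::euclidean_space \<Rightarrow> real \<Rightarrow> real) \<Rightarrow> 'a \<Rightarrow> real \<Rightarrow> bool" where
  "supersol_at d x t \<longleftrightarrow> twice_diff_at (\<lambda>y. d y t) x \<and>
     (\<exists>D. (d x has_real_derivative D) (at t) \<and> laplacian (\<lambda>y. d y t) x \<le> D)"

text \<open>The solution satisfies the heat inequality only weakly, so the strictness needed in the
  minimum principle is supplied by the barrier.\<close>

definition strict_subsol_at :: "('a::euclidean_space \<Rightarrow> real \<Rightarrow> real) \<Rightarrow> 'a \<Rightarrow> real \<Rightarrow> bool" where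
  "strict_subsol_at h x t \<longleftrightarrow> twice_diff_at (\<lambda>y. h y t) x \<and>
     (\<exists>D. (h x has_real_derivative D) (at t) \<and> D < laplacian (\<lambda>y. h y t) x)"

text \<open>The minimum principle is applied to \<open>d - \<epsilon> * h\<close>. \<open>P\<close>
  is the part of the parabolic boundary where \<open>h\<close> may be positive; there
  \<open>d\<close> has a positive minimum, while on the remaining part \<open>h\<close> is not
  positive and \<open>0 \<le> d\<close> is enough.\<close>

lemma barrier_comparison:
  fixes d h :: "'a::euclidean_space \<Rightarrow> real \<Rightarrow> real"
  assumes K: "compact K" and P: "compact P" "P \<subseteq> K"
    and cont: "continuous_on K (\<lambda>(x, t). d x t)" "continuous_on K (\<lambda>(x, t). h x t)"
    and nonneg: "\<And>x t. (x, t) \<in> K \<Longrightarrow> 0 \<le> d x t"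
    and pos: "\<And>x t. (x, t) \<in> P \<Longrightarrow> 0 < d x t"
    and super: "\<And>x t. (x, t) \<in> K \<Longrightarrow> (x, t) \<notin> P \<Longrightarrow> 0 < h x t \<Longrightarrow>
      (\<forall>\<^sub>F y in nhds x. (y, t) \<in> K) \<and> (\<forall>\<^sub>F s in at_left t. (x, s) \<in> K) \<and>
      supersol_at d x t \<and> strict_subsol_at h x t"
  shows "\<exists>\<epsilon>>0. \<forall>x t. (x, t) \<in> K \<longrightarrow> \<epsilon> * h x t \<le> d x t"
proof -
  obtain \<kappa> where \<kappa>: "\<kappa> > 0" "\<And>x t. (x, t) \<in> P \<Longrightarrow> \<kappa> \<le> d x t"
  proof (cases "P = {}")
    case True
    then show ?thesis using that[of 1] by auto
  next
    case False
    obtain p where p: "p \<in> P" "\<And>q. q \<in> P \<Longrightarrow> (\<lambda>(x, t). d x t) p \<le> (\<lambda>(x, t). d x t) q"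
      using continuous_attains_inf[OF P(1) False continuous_on_subset[OF cont(1) P(2)]] by blast
    then show ?thesis using that[of "(\<lambda>(x, t). d x t) p"] pos by (cases p) force
  qed
  have "bounded ((\<lambda>(x, t). h x t) ` K)"
    using compact_imp_bounded[OF compact_continuous_image[OF cont(2) K]] .
  then obtain M where M: "M > 0" "\<And>x t. (x, t) \<in> K \<Longrightarrow> \<bar>h x t\<bar> \<le> M"
    unfolding bounded_pos by force
  \<comment> \<open>This scale gives \<open>\<epsilon> * h \<le> \<kappa> \<le> d\<close> on
    \<open>P\<close>, so a negative value of the difference can occur only off \<open>P\<close> and
    where \<open>h\<close> is positive.\<close>
  define \<epsilon> where "\<epsilon> = \<kappa> / M"
  have \<epsilon>: "\<epsilon> > 0" using \<kappa> M by (simp add: \<epsilon>_def)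
  have neg: "(x, t) \<notin> P \<and> 0 < h x t" if "(x, t) \<in> K" "d x t - \<epsilon> * h x t < 0" for x t
  proof
    have "0 < \<epsilon> * h x t" using that nonneg by fastforce
    then show h: "0 < h x t" using \<epsilon> by (simp add: zero_less_mult_iff)
    have "\<epsilon> * h x t \<le> \<epsilon> * M" using \<epsilon> M(2)[OF that(1)] by (intro mult_left_mono) auto
    also have "\<dots> = \<kappa>" using M by (simp add: \<epsilon>_def)
    finally show "(x, t) \<notin> P" using \<kappa>(2)[of x t] that(2) by linarith
  qed
  have "0 \<le> d x t - \<epsilon> * h x t" if "(x, t) \<in> K" for x t
  proof (rule parabolic_minimum_principle[OF K _ _ _ that])
    show "continuous_on K (\<lambda>(x, t). d x t - \<epsilon> * h x t)"
      using cont by (auto simp: case_prod_unfold intro!: continuous_intros)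
    fix x t assume xt: "(x, t) \<in> K" "d x t - \<epsilon> * h x t < 0"
    note * = xt(1) neg[OF xt, THEN conjunct1] neg[OF xt, THEN conjunct2]
    show "(\<forall>\<^sub>F y in nhds x. (y, t) \<in> K) \<and> (\<forall>\<^sub>F s in at_left t. (x, s) \<in> K)"
      using super[OF *] by blast
    obtain D D' where D: "twice_diff_at (\<lambda>y. d y t) x" "twice_diff_at (\<lambda>y. h y t) x"
      "(d x has_real_derivative D) (at t)" "laplacian (\<lambda>y. d y t) x \<le> D"
      "(h x has_real_derivative D') (at t)" "D' < laplacian (\<lambda>y. h y t) x"
      using super[OF *] unfolding supersol_at_def strict_subsol_at_def by blast
    have "((\<lambda>t. d x t - \<epsilon> * h x t) has_real_derivative D - \<epsilon> * D') (at t)"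
      using D by (auto intro!: derivative_eq_intros)
    moreover have "laplacian (\<lambda>y. d y t) x - \<epsilon> * laplacian (\<lambda>y. h y t) x < D - \<epsilon> * D'"
      using D(4) mult_strict_left_mono[OF D(6) \<epsilon>] by linarith
    ultimately show "twice_diff_at (\<lambda>y. d y t - \<epsilon> * h y t) x \<and>
      (\<exists>D. ((\<lambda>t. d x t - \<epsilon> * h x t) has_real_derivative D) (at t) \<and>
        laplacian (\<lambda>y. d y t - \<epsilon> * h y t) x < D)"
      using D(1,2) by (auto simp: twice_diff_at_diff_cmult laplacian_diff_cmult)
  qed
  then show ?thesis using \<epsilon> by force
qed

section \<open>Spreading of positivity: a paraboloid barrier in balls, then connectedness\<close>

lemma
  fixes p x :: "'a::euclidean_space"
  shows twice_diff_at_paraboloid: "twice_diff_at (\<lambda>y. c - (norm (y - p))\<^sup>2) x"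
    and grad_paraboloid: "grad (\<lambda>y. c - (norm (y - p))\<^sup>2) x = - 2 *\<^sub>R (x - p)"
    and laplacian_paraboloid: "laplacian (\<lambda>y. c - (norm (y - p))\<^sup>2) x = - 2 * DIM('a)"
proof -
  let ?q = "\<lambda>y. c - (norm (y - p))\<^sup>2"
  have D: "(?q has_derivative (\<lambda>h. - 2 * (h \<bullet> (y - p)))) (at y)" for y
    unfolding power2_norm_eq_inner
    by (auto intro!: derivative_eq_intros simp: inner_commute)
  have par: "partial b ?q = (\<lambda>y. - 2 * (b \<bullet> (y - p)))" for b
    using partial_eqI[OF D] by auto
  have D2: "((\<lambda>y. - 2 * (b \<bullet> (y - p))) has_derivative (\<lambda>h. - 2 * (b \<bullet> h))) (at x)" for b
    by (auto intro!: derivative_eq_intros)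
  show "twice_diff_at ?q x"
    unfolding twice_diff_at_def par using D D2
    by (auto simp: differentiable_def intro!: always_eventually)
  show "laplacian ?q x = - 2 * DIM('a)"
    unfolding laplacian_def par partial_eqI[OF D2] by (simp add: inner_same_Basis)
  have "GDERIV ?q x :> - 2 *\<^sub>R (x - p)"
    using D[of x] by (simp add: gderiv_def)
  then show "grad ?q x = - 2 *\<^sub>R (x - p)" by (rule grad_eqI)
qed

lemma compact_sublevel:
  fixes F :: "'b::heine_borel \<Rightarrow> real"
  assumes "compact K" "continuous_on K F"
  shows "compact {p \<in> K. F p \<le> 0}"
proof -
  have "closed (K \<inter> F -` {..0})"
    using assms by (intro continuous_closed_preimage) (auto simp: compact_imp_closed)
  then have "compact (K \<inter> (K \<inter> F -` {..0}))"
    using assms(1) by blast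
  then show ?thesis by (simp add: vimage_def Int_def conj_ac)
qed

text \<open>The barrier is \<open>h = e\<^bsup>-l(t-t0)\<^esup> q\<^sup>2\<close> on the region \<open>q > 0\<close>, a ball around \<open>x0\<close> growing from radius
  \<open>r\<close> to \<open>R\<close>. For large \<open>l\<close> it is a strict subsolution: there \<open>h\<^sub>t - \<Delta>h\<close> is at most
  \<open>e\<^bsup>-l(t-t0)\<^esup> (-l q\<^sup>2 + M q - 8 r\<^sup>2)\<close>, and the quadratic has negative discriminant.\<close>

lemma positivity_spreads_in_ball:
  fixes d :: "'a::euclidean_space \<Rightarrow> real \<Rightarrow> real"
  assumes R: "0 < R" and t: "t0 < t1" and y: "y \<in> ball x0 R"
    and cont: "continuous_on (cball x0 R \<times> {t0..t1}) (\<lambda>(x, t). d x t)"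
    and nonneg: "\<And>x t. x \<in> cball x0 R \<Longrightarrow> t \<in> {t0..t1} \<Longrightarrow> 0 \<le> d x t"
    and super: "\<And>x t. x \<in> ball x0 R \<Longrightarrow> t \<in> {t0<..t1} \<Longrightarrow> supersol_at d x t"
    and pos: "0 < d x0 t0"
  shows "0 < d y t1"
proof -
  have "continuous_on (cball x0 R) (\<lambda>x. (\<lambda>(x, t). d x t) (x, t0))"
    by (rule continuous_on_compose2[OF cont]) (use t in \<open>auto intro!: continuous_intros\<close>)
  then obtain e where e: "e > 0" "\<And>x. x \<in> cball x0 R \<Longrightarrow> dist x x0 < e \<Longrightarrow> dist (d x t0) (d x0 t0) < d x0 t0"
    unfolding continuous_on_iff using pos R by (fastforce dest: bspec[of _ _ x0])
  \<comment> \<open>The starting ball, small enough that \<open>d\<close> is positive on it at time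
    \<open>t0\<close> by continuity.\<close>
  define r where "r = min e R / 2"
  have r: "0 < r" "r < R" "r < e" using e(1) R by (auto simp: r_def)
  have pos_r: "0 < d x t0" if "norm (x - x0) \<le> r" for x
    using e(2)[of x] that r by (force simp: dist_norm norm_minus_commute)
  \<comment> \<open>The growth rate for which the ball \<open>q \<ge> 0\<close> has squared radius
    \<open>r\<^sup>2\<close> at \<open>t0\<close> and exactly \<open>R\<^sup>2\<close> at
    \<open>t1\<close>.\<close>
  define k where "k = (R\<^sup>2 - r\<^sup>2) / (t1 - t0)"
  have k: "k > 0" using r t by (simp add: k_def power_strict_mono)
  have kt1: "k * (t1 - t0) = R\<^sup>2 - r\<^sup>2" using t by (simp add: k_def)
  define q where "q = (\<lambda>x t. r\<^sup>2 + k * (t - t0) - (norm (x - x0))\<^sup>2)"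
  \<comment> \<open>The coefficient of \<open>q\<close> in the subsolution inequality:
    \<open>2 * k\<close> from the time derivative, \<open>4 * DIM('a)\<close> from the Laplacian of
    \<open>q\<close>, and 8 from replacing the squared distance by
    \<open>r\<^sup>2 + k * (t - t0) - q\<close>.\<close>
  define M where "M = 2 * k + 4 * DIM('a) + 8"
  have M: "M > 0" using k by (simp add: M_def add_pos_nonneg)
  \<comment> \<open>With this \<open>l\<close> completing the square in
    \<open>l * q\<^sup>2 - M * q + 8 * r\<^sup>2\<close> leaves the positive remainder
    \<open>4 * r\<^sup>2\<close>; see \<open>sq\<close>.\<close>
  define l where "l = M\<^sup>2 / (16 * r\<^sup>2)"
  define h where "h = (\<lambda>x t. exp (- l * (t - t0)) * (q x t)\<^sup>2)"
  define K where "K = {p \<in> cball x0 R \<times> {t0..t1}. (\<lambda>(x, t). - q x t) p \<le> 0}"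
  define P where "P = cball x0 r \<times> {t0}"
  have K_iff: "(x, t) \<in> K \<longleftrightarrow> t \<in> {t0..t1} \<and> 0 \<le> q x t" for x t
  proof -
    have "norm (x - x0) \<le> R" if "t \<le> t1" "0 \<le> q x t"
    proof (rule power2_le_imp_le)
      have "(norm (x - x0))\<^sup>2 \<le> r\<^sup>2 + k * (t - t0)" using that by (simp add: q_def)
      also have "\<dots> \<le> r\<^sup>2 + k * (t1 - t0)" using that k by simp
      finally show "(norm (x - x0))\<^sup>2 \<le> R\<^sup>2" using kt1 by simp
    qed (use R in simp)
    then show ?thesis unfolding K_def by (auto simp: dist_norm norm_minus_commute)
  qed
  have "\<exists>\<epsilon>>0. \<forall>x t. (x, t) \<in> K \<longrightarrow> \<epsilon> * h x t \<le> d x t"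
  proof (rule barrier_comparison[where P = P])
    show "compact K" unfolding K_def
      by (intro compact_sublevel compact_Times)
        (auto simp: q_def case_prod_unfold intro!: continuous_intros)
    show "compact P" unfolding P_def by (intro compact_Times) auto
    show "P \<subseteq> K"
      using t r(1) by (auto simp: P_def K_iff q_def dist_norm norm_minus_commute intro: power_mono)
    show "continuous_on K (\<lambda>(x, t). d x t)"
      by (rule continuous_on_subset[OF cont]) (auto simp: K_def)
    show "continuous_on K (\<lambda>(x, t). h x t)"
      by (auto simp: h_def q_def case_prod_unfold intro!: continuous_intros)
    show "0 \<le> d x t" if "(x, t) \<in> K" for x t
      using that nonneg by (auto simp: K_def)
    show "0 < d x t" if "(x, t) \<in> P" for x t
      using that pos_r by (auto simp: P_def dist_norm norm_minus_commute)
    show "(\<forall>\<^sub>F z in nhds x. (z, t) \<in> K) \<and> (\<forall>\<^sub>F s in at_left t. (x, s) \<in> K) \<and>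
        supersol_at d x t \<and> strict_subsol_at h x t"
      if xt: "(x, t) \<in> K" "(x, t) \<notin> P" "0 < h x t" for x t
    proof -
      have t': "t \<in> {t0..t1}" and "q x t \<noteq> 0" "0 \<le> q x t" using xt by (auto simp: K_iff h_def)
      then have q: "q x t > 0" by simp
      \<comment> \<open>At the initial time the region \<open>q \<ge> 0\<close> is exactly the ball
        in \<open>P\<close>, so a point off \<open>P\<close> has room towards the past.\<close>
      have "t \<noteq> t0"
      proof
        assume "t = t0"
        then have "(norm (x - x0))\<^sup>2 \<le> r\<^sup>2" using q by (simp add: q_def)
        then have "norm (x - x0) \<le> r" by (rule power2_le_imp_le) (use r(1) in simp)
        then show False using xt(2) \<open>t = t0\<close> by (simp add: P_def dist_norm norm_minus_commute)
      qed
      then have t'': "t0 < t" "t \<le> t1" using t' by auto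
      have "open {z. 0 < q z t}" unfolding q_def
        by (intro open_Collect_less continuous_intros)
      then have "\<forall>\<^sub>F z in nhds x. 0 < q z t"
        using eventually_nhds_in_open[of "{z. 0 < q z t}" x] q by simp
      then have 1: "\<forall>\<^sub>F z in nhds x. (z, t) \<in> K"
        by eventually_elim (use t' in \<open>simp add: K_iff\<close>)
      have "open {s. t0 < s \<and> 0 < q x s}" unfolding q_def
        by (intro open_Collect_conj open_Collect_less continuous_intros)
      then have "\<forall>\<^sub>F s in nhds t. t0 < s \<and> 0 < q x s"
        using eventually_nhds_in_open[of "{s. t0 < s \<and> 0 < q x s}" t] q t'' by simp
      then have 2: "\<forall>\<^sub>F s in at_left t. (x, s) \<in> K"
        unfolding eventually_at_filter by eventually_elim (use t'' in \<open>simp add: K_iff\<close>)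
      have "(norm (x - x0))\<^sup>2 < r\<^sup>2 + k * (t - t0)" using q by (simp add: q_def)
      also have "\<dots> \<le> r\<^sup>2 + k * (t1 - t0)" using t'' k by simp
      finally have "(norm (x - x0))\<^sup>2 < R\<^sup>2" using kt1 by simp
      then have "norm (x - x0) < R" by (rule power2_less_imp_less) (use R in simp)
      then have "x \<in> ball x0 R" by (simp add: dist_norm norm_minus_commute)
      then have 3: "supersol_at d x t" using super t'' by simp
      define E where "E = exp (- l * (t - t0))"
      have E: "E > 0" by (simp add: E_def)
      have qp: "(\<lambda>y. q y t) = (\<lambda>y. (r\<^sup>2 + k * (t - t0)) - (norm (y - x0))\<^sup>2)"
        by (simp add: q_def)
      have tw: "twice_diff_at (\<lambda>y. q y t) x" unfolding qp by (rule twice_diff_at_paraboloid)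
      have F: "((\<lambda>s. E * s\<^sup>2) has_real_derivative 2 * E * s) (at s)"
        "((\<lambda>s. 2 * E * s) has_real_derivative 2 * E) (at s)" for s
        by (auto intro!: derivative_eq_intros)
      have hE: "(\<lambda>y. h y t) = (\<lambda>y. E * (q y t)\<^sup>2)" by (simp add: h_def E_def)
      have tw_h: "twice_diff_at (\<lambda>y. h y t) x"
        unfolding hE by (rule twice_diff_at_compose[OF tw F])
      have "laplacian (\<lambda>y. h y t) x = 2 * E * (norm (grad (\<lambda>y. q y t) x))\<^sup>2
          + 2 * E * q x t * laplacian (\<lambda>y. q y t) x"
        unfolding hE by (rule laplacian_compose[OF tw F])
      also have "norm (grad (\<lambda>y. q y t) x) = 2 * norm (x - x0)"
        unfolding qp grad_paraboloid by simp
      also have "laplacian (\<lambda>y. q y t) x = - 2 * DIM('a)"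
        unfolding qp by (rule laplacian_paraboloid)
      finally have lap: "laplacian (\<lambda>y. h y t) x =
          E * (8 * (norm (x - x0))\<^sup>2 - 4 * DIM('a) * q x t)"
        by (simp add: algebra_simps power2_eq_square)
      have Dh: "(h x has_real_derivative E * (- l * (q x t)\<^sup>2 + 2 * k * q x t)) (at t)"
        unfolding h_def q_def E_def
        by (auto intro!: derivative_eq_intros simp: algebra_simps)
      have sq: "l * (q x t)\<^sup>2 - M * q x t + 8 * r\<^sup>2 = (M * q x t / (4 * r) - 2 * r)\<^sup>2 + 4 * r\<^sup>2"
        using r(1) by (simp add: l_def power2_eq_square field_simps)
      have "0 < l * (q x t)\<^sup>2 - M * q x t + 8 * r\<^sup>2"
        unfolding sq using r(1) by (simp add: add_nonneg_pos)
      moreover have "(norm (x - x0))\<^sup>2 = r\<^sup>2 + k * (t - t0) - q x t" by (simp add: q_def)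
      moreover have "0 \<le> k * (t - t0)" using k t'' by simp
      ultimately have "- l * (q x t)\<^sup>2 + 2 * k * q x t <
          8 * (norm (x - x0))\<^sup>2 - 4 * DIM('a) * q x t"
        by (simp add: M_def algebra_simps)
      then have "E * (- l * (q x t)\<^sup>2 + 2 * k * q x t) < laplacian (\<lambda>y. h y t) x"
        unfolding lap using E by simp
      then have "strict_subsol_at h x t" unfolding strict_subsol_at_def using tw_h Dh by blast
      with 1 2 3 show ?thesis by blast
    qed
  qed
  then obtain \<epsilon> where \<epsilon>: "\<epsilon> > 0" "\<And>x t. (x, t) \<in> K \<Longrightarrow> \<epsilon> * h x t \<le> d x t"
    by blast
  have "norm (y - x0) < R" using y by (simp add: dist_norm norm_minus_commute)
  then have "(norm (y - x0))\<^sup>2 < R\<^sup>2" by (intro power_strict_mono) auto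
  then have "q y t1 > 0" using kt1 by (simp add: q_def)
  then have "(y, t1) \<in> K" "h y t1 > 0" using t by (auto simp: K_iff h_def)
  then show ?thesis using \<epsilon> by (metis less_le_trans mult_pos_pos)
qed

text \<open>The set \<open>S\<close> of points that are positive at all later times is open and
  closed relative to \<Omega>, by spreading over small balls, and contains
  \<open>x0\<close>.\<close>

lemma strong_positivity:
  fixes d :: "'a::euclidean_space \<Rightarrow> real \<Rightarrow> real"
  assumes \<Omega>: "open \<Omega>" "connected \<Omega>"
    and cont: "continuous_on (\<Omega> \<times> {t0..}) (\<lambda>(x, t). d x t)"
    and nonneg: "\<And>x t. x \<in> \<Omega> \<Longrightarrow> t0 \<le> t \<Longrightarrow> 0 \<le> d x t"
    and super: "\<And>x t. x \<in> \<Omega> \<Longrightarrow> t0 < t \<Longrightarrow> supersol_at d x t"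
    and x0: "x0 \<in> \<Omega>" and pos: "0 < d x0 t0"
    and "x \<in> \<Omega>" "t0 < t"
  shows "0 < d x t"
proof -
  have spread: "0 < d z s" if "cball y R \<subseteq> \<Omega>" "z \<in> ball y R" "t0 \<le> r" "r < s" "0 < d y r" for y z r s R
  proof (rule positivity_spreads_in_ball[of R r s z y])
    show "0 < R" using that(2) by (metis ball_eq_empty empty_iff not_le)
    show "continuous_on (cball y R \<times> {r..s}) (\<lambda>(x, t). d x t)"
      by (rule continuous_on_subset[OF cont]) (use that in auto)
  qed (use that nonneg super in \<open>auto simp: subset_iff\<close>)
  define S where "S = {y \<in> \<Omega>. \<forall>s>t0. 0 < d y s}"
  \<comment> \<open>To reach every time \<open>s > t0\<close> it is enough that the centre is
    positive at some earlier time, which may be \<open>t0\<close> itself; this covers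
    \<open>x0\<close> and the points of \<open>S\<close> alike.\<close>
  have sub: "ball y R \<subseteq> S" if "cball y R \<subseteq> \<Omega>" "\<And>s. s > t0 \<Longrightarrow> \<exists>r. t0 \<le> r \<and> r < s \<and> 0 < d y r" for y R
  proof
    fix z assume z: "z \<in> ball y R"
    then have "z \<in> \<Omega>" using that(1) by auto
    then show "z \<in> S" unfolding S_def using spread[OF that(1) z] that(2) by blast
  qed
  have S: "\<exists>r. t0 \<le> r \<and> r < s \<and> 0 < d y r" if "y \<in> S" "s > t0" for y s
    using that dense[of t0 s] by (auto simp: S_def intro: less_imp_le)
  have "open S"
  proof (subst open_contains_ball, rule ballI)
    fix y assume y: "y \<in> S"
    then obtain R where "R > 0" "cball y R \<subseteq> \<Omega>"
      using \<Omega>(1) unfolding open_contains_cball S_def by blast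
    then show "\<exists>e>0. ball y e \<subseteq> S" using sub[of y R] S[OF y] by blast
  qed
  moreover have "open (\<Omega> - S)"
  proof (subst open_contains_ball, rule ballI)
    fix y assume y: "y \<in> \<Omega> - S"
    then obtain R where R: "R > 0" "cball y R \<subseteq> \<Omega>"
      using \<Omega>(1) unfolding open_contains_cball by blast
    \<comment> \<open>Half the radius keeps the ball around \<open>z\<close> inside \<Omega> and
      large enough to contain \<open>y\<close>, so \<open>z \<in> S\<close> would force
      \<open>y \<in> S\<close>.\<close>
    have "z \<notin> S" if "z \<in> ball y (R / 2)" for z
    proof
      assume z: "z \<in> S"
      have "cball z (R / 2) \<subseteq> cball y R"
        using that by (intro cball_subset_cball_iff[THEN iffD2]) (auto simp: dist_commute)
      then have "ball z (R / 2) \<subseteq> S" using R S[OF z] by (intro sub) auto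
      then show False using that y by (auto simp: dist_commute subset_iff)
    qed
    moreover have "ball y (R / 2) \<subseteq> \<Omega>" using R by (auto simp: subset_iff)
    ultimately show "\<exists>e>0. ball y e \<subseteq> \<Omega> - S" using R(1) by (intro exI[of _ "R / 2"]) auto
  qed
  ultimately have "S \<inter> \<Omega> = {} \<or> (\<Omega> - S) \<inter> \<Omega> = {}"
    using \<Omega>(2) by (intro connectedD) (auto simp: S_def)
  moreover have "x0 \<in> S"
  proof -
    obtain R where "R > 0" "cball x0 R \<subseteq> \<Omega>"
      using \<Omega>(1) x0 unfolding open_contains_cball by blast
    then show ?thesis using sub[of x0 R] pos by (metis centre_in_ball order_refl subsetD)
  qed
  ultimately show ?thesis using assms(8,9) x0 by (auto simp: S_def)
qed

section \<open>Hopf's boundary point lemma\<close>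

lemma continuous_on_partials:
  assumes "Ck_on 2 U w" "b \<in> Basis"
  shows "continuous_on U (partial b w)"
  using assms by (auto simp: numeral_2_eq_2 intro!: continuous_at_imp_continuous_on
      differentiable_imp_continuous_within)

lemma continuous_on_grad: "Ck_on 2 U w \<Longrightarrow> continuous_on U (grad w)"
  unfolding grad_def by (intro continuous_intros continuous_on_partials) auto

lemma continuous_on_laplacian: "Ck_on 2 U w \<Longrightarrow> continuous_on U (laplacian w)"
  unfolding laplacian_def by (intro continuous_intros) (auto simp: numeral_2_eq_2)

text \<open>The barrier \<open>h = e\<^bsup>-l \<phi>\<^esup> - 1\<close> with \<open>\<phi> = \<rho> + (t1 - t) + |x - x1|\<^sup>2\<close> needs no interior ball: the
  added terms make the region \<open>\<phi> \<le> 0\<close> touch the boundary of \<open>\<Omega>\<close> at \<open>(x1, t1)\<close> only.\<close>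

lemma hopf_lemma:
  fixes d :: "'a::euclidean_space \<Rightarrow> real \<Rightarrow> real"
  assumes \<rho>: "local_defining_function \<Omega> x1 U \<rho>" and x1: "x1 \<in> frontier \<Omega>"
    and \<nu>: "\<nu> x1 = sgn (grad \<rho> x1)" and a: "a < t1" and "0 < r0"
    and cont: "continuous_on (closure \<Omega> \<times> {a..t1}) (\<lambda>(x, t). d x t)"
    and nonneg: "\<And>x t. x \<in> closure \<Omega> \<Longrightarrow> t \<in> {a..t1} \<Longrightarrow> 0 \<le> d x t"
    and pos: "\<And>x t. x \<in> \<Omega> \<Longrightarrow> t \<in> {a..t1} \<Longrightarrow> 0 < d x t"
    and super: "\<And>x t. x \<in> \<Omega> \<Longrightarrow> x \<in> ball x1 r0 \<Longrightarrow> t \<in> {a<..t1} \<Longrightarrow> supersol_at d x t"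
    and zero: "d x1 t1 = 0" and D: "has_normal_derivative (\<lambda>y. d y t1) D \<nu> x1"
  shows "D < 0"
proof -
  have U: "open U" "x1 \<in> U" and C2: "Ck_on 2 U \<rho>" and grad0: "grad \<rho> x1 \<noteq> 0"
    and in_\<Omega>: "\<And>y. y \<in> U \<Longrightarrow> \<rho> y < 0 \<Longrightarrow> y \<in> \<Omega>"
    and in_frontier: "\<And>y. y \<in> U \<Longrightarrow> \<rho> y = 0 \<Longrightarrow> y \<in> frontier \<Omega>"
    and \<rho>0: "\<rho> x1 = 0"
    using \<rho> x1 by (auto simp: local_defining_function_def smooth_on_def)
  have tw_\<rho>: "twice_diff_at \<rho> x" and diff_\<rho>: "\<rho> differentiable at x" if "x \<in> U" for x
    using twice_diff_at_if_Ck_on[OF C2 U(1) that] C2 that by (auto simp: numeral_2_eq_2)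
  \<comment> \<open>Near \<open>x1\<close> this is a lower bound for \<open>N\<close>, the norm of
    the spatial gradient of \<phi>, which equals \<open>2 * b\<close> at \<open>x1\<close>.\<close>
  define b where "b = norm (grad \<rho> x1) / 2"
  have b: "b > 0" using grad0 by (simp add: b_def)
  define N where "N = (\<lambda>x. norm (grad \<rho> x + 2 *\<^sub>R (x - x1)))"
  have "isCont N x1"
    using continuous_on_grad[OF C2] U unfolding N_def
    by (intro continuous_intros) (simp add: continuous_on_eq_continuous_at)
  moreover have "b < N x1" using b by (simp add: N_def b_def)
  ultimately have "\<forall>\<^sub>F x in at x1. b < N x"
    unfolding isCont_def by (rule order_tendstoD)
  then have "\<forall>\<^sub>F x in nhds x1. b < N x"
    using \<open>b < N x1\<close> by (simp add: eventually_nhds_conv_at)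
  moreover have "\<forall>\<^sub>F x in nhds x1. x \<in> U" "\<forall>\<^sub>F x in nhds x1. x \<in> ball x1 r0"
    using U \<open>0 < r0\<close> by (intro eventually_nhds_in_open; simp)+
  ultimately have "\<forall>\<^sub>F x in nhds x1. b < N x \<and> x \<in> U \<and> x \<in> ball x1 r0"
    by eventually_elim auto
  then obtain e where e: "e > 0" "\<And>x. dist x x1 < e \<Longrightarrow> b < N x \<and> x \<in> U \<and> x \<in> ball x1 r0"
    unfolding eventually_nhds_metric by blast
  define r where "r = e / 2"
  have r: "r > 0" and near: "\<And>x. x \<in> cball x1 r \<Longrightarrow> b < N x \<and> x \<in> U \<and> x \<in> ball x1 r0"
    using e by (auto simp: r_def dist_commute)
  have \<rho>_cont: "continuous_on (cball x1 r) \<rho>"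
    using diff_\<rho> near by (auto intro!: continuous_at_imp_continuous_on differentiable_imp_continuous_within)
  have "bounded (laplacian \<rho> ` cball x1 r)"
    using near by (intro compact_imp_bounded compact_continuous_image
        continuous_on_subset[OF continuous_on_laplacian[OF C2]]) auto
  then obtain C where C: "C > 0" "\<And>x. x \<in> cball x1 r \<Longrightarrow> \<bar>laplacian \<rho> x\<bar> \<le> C"
    unfolding bounded_pos by auto
  \<comment> \<open>Chosen so that \<open>l * b\<^sup>2\<close> exceeds the Laplacian of \<phi> by
    at least 2. The barrier inequality \<open>l * E < laplacian h\<close> asks for an excess of more
    than 1, the 1 coming from the time derivative.\<close>
  define l where "l = (C + 2 * DIM('a) + 2) / b\<^sup>2"
  have l: "l > 0" using C b by (simp add: l_def add_pos_nonneg)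
  \<comment> \<open>The factor 1 brings \<phi> into the form \<open>v - c * w\<close> of the
    calculus rules.\<close>
  define \<phi> where "\<phi> = (\<lambda>x t. \<rho> x - 1 * ((t - t1) - (norm (x - x1))\<^sup>2))"
  define h where "h = (\<lambda>x t. exp (- l * \<phi> x t) - 1)"
  define K where "K = {p \<in> cball x1 r \<times> {a..t1}. (\<lambda>(x, t). \<phi> x t) p \<le> 0}"
  \<comment> \<open>The lateral sphere and the initial time. Both avoid \<open>(x1, t1)\<close>, so
    by \<open>\<rho>_neg\<close> all of \<open>P\<close> lies over \<Omega>, where \<open>d\<close>
    is positive; where \<phi> vanishes, so does the barrier.\<close>
  define P where "P = K \<inter> (sphere x1 r \<times> UNIV \<union> UNIV \<times> {a})"
  have K_iff: "(x, t) \<in> K \<longleftrightarrow> x \<in> cball x1 r \<and> t \<in> {a..t1} \<and> \<phi> x t \<le> 0" for x t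
    by (auto simp: K_def)
  have P_iff: "(x, t) \<in> P \<longleftrightarrow> (x, t) \<in> K \<and> (dist x1 x = r \<or> t = a)" for x t
    by (auto simp: P_def)
  \<comment> \<open>On \<open>K\<close> the value of \<rho> is a sum of three nonpositive terms, and
    each alternative makes one of them strictly negative.\<close>
  have \<rho>_neg: "\<rho> x < 0" if "(x, t) \<in> K" "x \<noteq> x1 \<or> t < t1 \<or> \<phi> x t < 0" for x t
  proof -
    have "0 < norm (x - x1) \<or> t < t1 \<or> \<phi> x t < 0" using that by auto
    then have "0 < (norm (x - x1))\<^sup>2 \<or> t < t1 \<or> \<phi> x t < 0" by (metis zero_less_power)
    moreover have "\<rho> x = \<phi> x t - (t1 - t) - (norm (x - x1))\<^sup>2" by (simp add: \<phi>_def)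
    moreover have "0 \<le> (norm (x - x1))\<^sup>2" "t \<le> t1" "\<phi> x t \<le> 0" using that by (auto simp: K_iff)
    ultimately show ?thesis by linarith
  qed
  have K_closure: "x \<in> closure \<Omega>" if "(x, t) \<in> K" for x t
  proof (cases "x = x1")
    case True
    then show ?thesis using x1 by (simp add: frontier_def)
  next
    case False
    then show ?thesis using in_\<Omega>[of x] \<rho>_neg[OF that] near that closure_subset
      by (auto simp: K_iff)
  qed
  have cont_\<phi>: "continuous_on (cball x1 r \<times> T) (\<lambda>(x, t). \<phi> x t)" for T
    unfolding \<phi>_def case_prod_unfold
    by (intro continuous_intros continuous_on_compose2[OF \<rho>_cont]) auto
  have "\<exists>\<epsilon>>0. \<forall>x t. (x, t) \<in> K \<longrightarrow> \<epsilon> * h x t \<le> d x t"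
  proof (rule barrier_comparison[where P = P])
    show compK: "compact K" unfolding K_def
      by (intro compact_sublevel compact_Times cont_\<phi>) auto
    show "compact P"
      unfolding P_def by (intro compact_Int_closed compK closed_Un closed_Times) auto
    show "P \<subseteq> K" by (auto simp: P_def)
    show "continuous_on K (\<lambda>(x, t). d x t)"
      by (rule continuous_on_subset[OF cont]) (use K_closure in \<open>auto simp: K_iff\<close>)
    have "continuous_on K (\<lambda>(x, t). \<phi> x t)"
      by (rule continuous_on_subset[OF cont_\<phi>[of "{a..t1}"]]) (auto simp: K_iff)
    then show "continuous_on K (\<lambda>(x, t). h x t)"
      unfolding h_def case_prod_unfold by (intro continuous_intros)
    show "0 \<le> d x t" if "(x, t) \<in> K" for x t
      using that K_closure nonneg by (auto simp: K_iff)
    show "0 < d x t" if "(x, t) \<in> P" for x t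
    proof -
      have K: "(x, t) \<in> K" using that by (simp add: P_iff)
      have "x \<noteq> x1 \<or> t < t1" using that r a by (auto simp: P_iff)
      then have "x \<in> \<Omega>" using in_\<Omega> \<rho>_neg[OF K] near K by (auto simp: K_iff)
      then show ?thesis using pos K by (simp add: K_iff)
    qed
    show "(\<forall>\<^sub>F z in nhds x. (z, t) \<in> K) \<and> (\<forall>\<^sub>F s in at_left t. (x, s) \<in> K) \<and>
        supersol_at d x t \<and> strict_subsol_at h x t"
      if xt: "(x, t) \<in> K" "(x, t) \<notin> P" "0 < h x t" for x t
    proof -
      have \<phi>0: "\<phi> x t < 0" using xt(3) l by (simp add: h_def mult_less_0_iff)
      have x: "x \<in> ball x1 r" and t: "a < t" "t \<le> t1" using xt(1,2) by (auto simp: P_iff K_iff)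
      then have xc: "x \<in> cball x1 r" by simp
      have "isCont (\<lambda>z. \<phi> z t) x"
        unfolding \<phi>_def using differentiable_imp_continuous_within[OF diff_\<rho>[of x]] near[OF xc]
        by (intro continuous_intros) auto
      then have "\<forall>\<^sub>F z in at x. \<phi> z t < 0"
        unfolding isCont_def using \<phi>0 by (rule order_tendstoD)
      then have "\<forall>\<^sub>F z in nhds x. \<phi> z t < 0"
        using \<phi>0 by (simp add: eventually_nhds_conv_at)
      moreover have "\<forall>\<^sub>F z in nhds x. z \<in> ball x1 r"
        using x by (intro eventually_nhds_in_open) auto
      ultimately have 1: "\<forall>\<^sub>F z in nhds x. (z, t) \<in> K"
        by eventually_elim (use t in \<open>auto simp: K_iff\<close>)
      have "open {s. a < s \<and> \<phi> x s < 0}" unfolding \<phi>_def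
        by (intro open_Collect_conj open_Collect_less continuous_intros)
      then have "\<forall>\<^sub>F s in nhds t. a < s \<and> \<phi> x s < 0"
        using eventually_nhds_in_open[of "{s. a < s \<and> \<phi> x s < 0}" t] \<phi>0 t by simp
      then have 2: "\<forall>\<^sub>F s in at_left t. (x, s) \<in> K"
        unfolding eventually_at_filter by eventually_elim (use xc t in \<open>simp add: K_iff\<close>)
      have "x \<in> \<Omega>" using in_\<Omega> \<rho>_neg[OF xt(1)] \<phi>0 near[OF xc] by auto
      then have 3: "supersol_at d x t" using super near[OF xc] t by simp
      define E where "E = exp (- l * \<phi> x t)"
      have E: "E > 0" by (simp add: E_def)
      have xU: "x \<in> U" using near[OF xc] by simp
      have tw: "twice_diff_at (\<lambda>y. \<phi> y t) x"
        unfolding \<phi>_def by (intro twice_diff_at_diff_cmult tw_\<rho> xU twice_diff_at_paraboloid)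
      have lap_\<phi>: "laplacian (\<lambda>y. \<phi> y t) x = laplacian \<rho> x + 2 * DIM('a)"
        unfolding \<phi>_def
        by (simp add: laplacian_diff_cmult[OF tw_\<rho>[OF xU] twice_diff_at_paraboloid, where c = 1, simplified]
          laplacian_paraboloid)
      have "(\<lambda>y. (t - t1) - (norm (y - x1))\<^sup>2) differentiable at x"
        using twice_diff_at_paraboloid eventually_nhds_x_imp_x unfolding twice_diff_at_def by blast
      from partial_diff_cmult[OF diff_\<rho>[OF xU] this, of _ 1]
      have "grad (\<lambda>y. \<phi> y t) x = grad \<rho> x - grad (\<lambda>y. (t - t1) - (norm (y - x1))\<^sup>2) x"
        unfolding \<phi>_def grad_def by (simp only: mult_1 scaleR_left_diff_distrib sum_subtractf)
      then have grad_\<phi>: "norm (grad (\<lambda>y. \<phi> y t) x) = N x"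
        unfolding grad_paraboloid by (simp add: N_def)
      have F: "((\<lambda>s. exp (- l * s) - 1) has_real_derivative - l * exp (- l * s)) (at s)"
        "((\<lambda>s. - l * exp (- l * s)) has_real_derivative l\<^sup>2 * exp (- l * s)) (at s)" for s
        by (auto intro!: derivative_eq_intros simp: power2_eq_square)
      have tw_h: "twice_diff_at (\<lambda>y. h y t) x"
        unfolding h_def by (rule twice_diff_at_compose[OF tw F])
      have lap: "laplacian (\<lambda>y. h y t) x =
          l * E * (l * (N x)\<^sup>2 - (laplacian \<rho> x + 2 * DIM('a)))"
        unfolding h_def laplacian_compose[OF tw F] grad_\<phi> lap_\<phi>
        by (simp add: E_def power2_eq_square algebra_simps)
      have Dh: "(h x has_real_derivative l * E) (at t)"
        unfolding h_def \<phi>_def E_def by (auto intro!: derivative_eq_intros)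
      have "b\<^sup>2 \<le> (N x)\<^sup>2" using near[OF xc] b by (intro power_mono) auto
      then have "l * b\<^sup>2 \<le> l * (N x)\<^sup>2" using l by simp
      moreover have "l * b\<^sup>2 = C + 2 * DIM('a) + 2" using b by (simp add: l_def)
      ultimately have "1 < l * (N x)\<^sup>2 - (laplacian \<rho> x + 2 * DIM('a))"
        using C(2)[OF xc] by linarith
      then have "l * E < laplacian (\<lambda>y. h y t) x" unfolding lap using l E by simp
      then have "strict_subsol_at h x t" unfolding strict_subsol_at_def using tw_h Dh by blast
      with 1 2 3 show ?thesis by blast
    qed
  qed
  then obtain \<epsilon> where \<epsilon>: "\<epsilon> > 0" "\<And>x t. (x, t) \<in> K \<Longrightarrow> \<epsilon> * h x t \<le> d x t"
    by blast
  \<comment> \<open>The function \<phi> at time \<open>t1\<close> along the normal line. Its slope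
    at 0 is \<open>2 * b > 0\<close>, so it is negative just inside and that segment lies in
    \<open>K\<close>.\<close>
  define \<psi> where "\<psi> = (\<lambda>s. \<rho> (x1 + s *\<^sub>R \<nu> x1) + s\<^sup>2 * (norm (\<nu> x1))\<^sup>2)"
  have \<psi>: "\<psi> s = \<phi> (x1 + s *\<^sub>R \<nu> x1) t1" for s
    by (simp add: \<psi>_def \<phi>_def power_mult_distrib)
  have "((\<lambda>s. x1 + s *\<^sub>R \<nu> x1) has_derivative (\<lambda>s. s *\<^sub>R \<nu> x1)) (at 0)"
    by (auto intro!: derivative_eq_intros)
  from has_derivative_compose[OF this, of \<rho> "\<lambda>h. h \<bullet> grad \<rho> x1"]
  have "((\<lambda>s. \<rho> (x1 + s *\<^sub>R \<nu> x1)) has_derivative (\<lambda>s. (s *\<^sub>R \<nu> x1) \<bullet> grad \<rho> x1)) (at 0)"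
    using has_derivative_grad[OF diff_\<rho>[OF U(2)]] by simp
  moreover have "\<nu> x1 \<bullet> grad \<rho> x1 = 2 * b"
    using grad0 by (simp add: \<nu> b_def sgn_div_norm power2_norm_eq_inner[symmetric] power2_eq_square)
  ultimately have "((\<lambda>s. \<rho> (x1 + s *\<^sub>R \<nu> x1)) has_real_derivative 2 * b) (at 0)"
    by (auto intro: has_derivative_imp_has_field_derivative)
  then have D\<psi>: "(\<psi> has_real_derivative 2 * b) (at 0)"
    unfolding \<psi>_def by (auto intro!: derivative_eq_intros)
  obtain c where c: "c > 0" "\<And>s. 0 < s \<Longrightarrow> s < c \<Longrightarrow> \<psi> (0 - s) < \<psi> 0"
    using DERIV_pos_inc_left[OF D\<psi>] b by auto
  have \<psi>0: "\<psi> 0 = 0" by (simp add: \<psi>_def \<rho>0)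
  have "\<forall>\<^sub>F s in at_left 0. s \<in> {- min c r<..<0}"
    using c(1) r by (intro eventually_at_leftI[of "- min c r"]) auto
  then have le: "\<forall>\<^sub>F s in at_left 0. \<epsilon> * (exp (- l * \<psi> s) - 1) \<le> d (x1 + s *\<^sub>R \<nu> x1) t1"
  proof eventually_elim
    case (elim s)
    have "norm (\<nu> x1) \<le> 1" by (simp add: \<nu> norm_sgn)
    then have "\<bar>s\<bar> * norm (\<nu> x1) \<le> r" using elim by (smt (verit) mult_left_le greaterThanLessThan_iff)
    moreover have "\<psi> s < 0" using c(2)[of "- s"] elim \<psi>0 by auto
    ultimately have "(x1 + s *\<^sub>R \<nu> x1, t1) \<in> K" using a by (simp add: K_iff \<psi> dist_norm)
    from \<epsilon>(2)[OF this] show ?case by (simp add: h_def \<psi>)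
  qed
  \<comment> \<open>Along the normal \<open>d - \<epsilon> * h\<close> is nonnegative inside and
    zero at \<open>x1\<close>, so its left derivative is nonpositive; the barrier contributes the
    positive amount \<open>2 * \<epsilon> * l * b\<close>.\<close>
  have "D + 2 * \<epsilon> * l * b \<le> 0"
  proof (rule left_derivative_nonpos_at_min)
    show "((\<lambda>s. d (x1 + s *\<^sub>R \<nu> x1) t1 - \<epsilon> * (exp (- l * \<psi> s) - 1)) has_real_derivative
        D + 2 * \<epsilon> * l * b) (at_left 0)"
      using D[unfolded has_normal_derivative_def] has_field_derivative_at_within[OF D\<psi>]
      by (auto intro!: derivative_eq_intros simp: \<psi>0)
    show "\<forall>\<^sub>F s in at_left 0. d (x1 + 0 *\<^sub>R \<nu> x1) t1 - \<epsilon> * (exp (- l * \<psi> 0) - 1)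
        \<le> d (x1 + s *\<^sub>R \<nu> x1) t1 - \<epsilon> * (exp (- l * \<psi> s) - 1)"
      using le by eventually_elim (simp add: \<psi>0 zero)
  qed
  moreover have "0 < 2 * \<epsilon> * l * b" using \<epsilon>(1) l b by simp
  ultimately show ?thesis by linarith
qed

section \<open>Comparison for global solutions\<close>

lemma
  fixes c :: real and x :: "'a::euclidean_space"
  shows twice_diff_at_const: "twice_diff_at (\<lambda>_. c) x"
    and laplacian_const: "laplacian (\<lambda>_. c) x = 0"
proof -
  have par: "partial b (\<lambda>_. k) = (\<lambda>_. 0)" for b :: 'a and k :: real
    by (rule ext, rule partial_eqI[where w' = "\<lambda>_. 0"]) simp
  show "twice_diff_at (\<lambda>_. c) x" by (simp add: twice_diff_at_def par)
  show "laplacian (\<lambda>_. c) x = 0" by (simp add: laplacian_def par)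
qed

text \<open>The conditions on all finite cylinders are merged into one on the infinite cylinder, and
  the boundary condition is kept as the sign of the flux, the form in which it contradicts Hopf's
  lemma.\<close>

locale global_solution =
  fixes \<Omega> :: "'a::euclidean_space set" and \<nu> :: "'a \<Rightarrow> 'a"
    and \<alpha> f :: "real \<Rightarrow> real" and u :: "'a \<Rightarrow> real \<Rightarrow> real"
  assumes domain: "bounded_domain \<Omega>"
    and normal: "unit_exterior_normal \<Omega> \<nu>"
    and cont_f: "continuous_on {0..} f" and f_nonneg: "\<And>s. s \<ge> 0 \<Longrightarrow> f s \<ge> 0"
    and cont_\<alpha>: "continuous_on {0..} \<alpha>" and \<alpha>_nonneg: "\<And>t. t \<ge> 0 \<Longrightarrow> \<alpha> t \<ge> 0"
    and cont: "continuous_on (closure \<Omega> \<times> {0..}) (\<lambda>(x, t). u x t)"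
    and nonneg: "\<And>x t. x \<in> closure \<Omega> \<Longrightarrow> 0 \<le> t \<Longrightarrow> 0 \<le> u x t"
    and twice_diff: "\<And>x t. x \<in> \<Omega> \<Longrightarrow> 0 < t \<Longrightarrow> twice_diff_at (\<lambda>y. u y t) x"
    and equation: "\<And>x t. x \<in> \<Omega> \<Longrightarrow> 0 < t \<Longrightarrow>
      (u x has_real_derivative laplacian (\<lambda>y. u y t) x + \<alpha> t * f (u x t)) (at t)"
    and flux: "\<And>x t. x \<in> frontier \<Omega> \<Longrightarrow> 0 < t \<Longrightarrow>
      \<exists>D\<ge>0. has_normal_derivative (\<lambda>y. u y t) D \<nu> x"
begin

lemma compact_closed_domain: "compact (closure \<Omega>)"
  using domain by (simp add: bounded_domain_def)

lemma in_closure: "x \<in> \<Omega> \<Longrightarrow> x \<in> closure \<Omega>"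
  using closure_subset by auto

lemma cont_time:
  assumes "x \<in> closure \<Omega>"
  shows "continuous_on {0..} (u x)"
proof -
  have "continuous_on {0..} (\<lambda>t. (\<lambda>(x, t). u x t) (x, t))"
    by (intro continuous_on_compose2[OF cont]) (use assms in \<open>auto intro!: continuous_intros\<close>)
  then show ?thesis by simp
qed

text \<open>If \<open>u\<close> met \<open>z\<close> at \<open>x1\<close>, Hopf's lemma for
  \<open>u - z\<close> would give a negative normal derivative, but \<open>z\<close> is constant in
  space and the flux of \<open>u\<close> is nonnegative. The inequality for \<open>z'\<close> is
  asked only near \<open>x1\<close>, since in \<open>comparison\<close> it comes from continuity at
  a contact point.\<close>

lemma boundary_positivity:
  assumes a: "0 \<le> a" "a < t1"
    and z: "\<And>t. t \<in> {a..t1} \<Longrightarrow> (z has_real_derivative z' t) (at t)"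
    and le: "\<And>x t. x \<in> closure \<Omega> \<Longrightarrow> t \<in> {a..t1} \<Longrightarrow> z t \<le> u x t"
    and less: "\<And>x t. x \<in> \<Omega> \<Longrightarrow> t \<in> {a..t1} \<Longrightarrow> z t < u x t"
    and x1: "x1 \<in> frontier \<Omega>" and "0 < r0"
    and z': "\<And>x t. x \<in> \<Omega> \<Longrightarrow> x \<in> ball x1 r0 \<Longrightarrow> t \<in> {a<..t1} \<Longrightarrow> z' t \<le> \<alpha> t * f (u x t)"
  shows "z t1 < u x1 t1"
proof (rule ccontr)
  assume "\<not> z t1 < u x1 t1"
  then have zero: "u x1 t1 - z t1 = 0"
    using le[of x1 t1] x1 a by (auto simp: frontier_def)
  obtain U \<rho> where \<rho>: "local_defining_function \<Omega> x1 U \<rho>" "\<nu> x1 = sgn (grad \<rho> x1)"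
    using normal x1 unfolding unit_exterior_normal_def by blast
  obtain D where D: "D \<ge> 0" "has_normal_derivative (\<lambda>y. u y t1) D \<nu> x1"
    using flux[OF x1, of t1] a by auto
  have "D < 0"
  proof (rule hopf_lemma[where d = "\<lambda>x t. u x t - z t" and \<nu> = \<nu> and \<rho> = \<rho> and ?x1.0 = x1, OF \<rho>(1) x1 \<rho>(2) a(2) \<open>0 < r0\<close>])
    show "u x1 t1 - z t1 = 0" by (rule zero)
    have cont_z: "continuous_on {a..t1} z"
      by (intro continuous_at_imp_continuous_on ballI DERIV_isCont[OF z])
    show "continuous_on (closure \<Omega> \<times> {a..t1}) (\<lambda>(x, t). u x t - z t)"
      unfolding case_prod_unfold
      by (intro continuous_on_diff continuous_on_compose2[OF cont_z]
          continuous_on_subset[OF cont[unfolded case_prod_unfold]])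
        (use a in \<open>auto intro!: continuous_intros\<close>)
    show "has_normal_derivative (\<lambda>y. u y t1 - z t1) D \<nu> x1"
      using D(2) unfolding has_normal_derivative_def by (auto intro!: derivative_eq_intros)
    fix x t assume xt: "x \<in> \<Omega>" "x \<in> ball x1 r0" "t \<in> {a<..t1}"
    then have t: "0 < t" using a by simp
    have "twice_diff_at (\<lambda>y. u y t - 1 * z t) x"
      using twice_diff_at_diff_cmult[OF twice_diff[OF xt(1) t] twice_diff_at_const] .
    moreover have "laplacian (\<lambda>y. u y t - 1 * z t) x = laplacian (\<lambda>y. u y t) x"
      by (subst laplacian_diff_cmult[OF twice_diff[OF xt(1) t] twice_diff_at_const])
        (simp add: laplacian_const)
    moreover have "((\<lambda>t. u x t - z t) has_real_derivative
        laplacian (\<lambda>y. u y t) x + \<alpha> t * f (u x t) - z' t) (at t)"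
      using equation[OF xt(1) t] z[of t] xt(3) by (auto intro!: derivative_eq_intros)
    moreover have "laplacian (\<lambda>y. u y t) x \<le> laplacian (\<lambda>y. u y t) x + \<alpha> t * f (u x t) - z' t"
      using z'[OF xt] by simp
    ultimately show "supersol_at (\<lambda>x t. u x t - z t) x t"
      unfolding supersol_at_def by auto
  qed (use le less in auto)
  with D(1) show False by simp
qed

text \<open>The given nonzero value may sit on the boundary or at time 0. Continuity moves it to an
  interior point at a positive time, strong positivity carries it through \<Omega>, and Hopf's lemma
  reaches the boundary.\<close>

lemma eventually_positive:
  assumes "y \<in> closure \<Omega>" "0 \<le> s" "u y s \<noteq> 0"
  obtains t where "0 < t" "\<And>x. x \<in> closure \<Omega> \<Longrightarrow> 0 < u x t"
proof -
  have "0 < u y s" using nonneg[OF assms(1,2)] assms(3) by simp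
  then obtain e where e: "e > 0"
    "\<And>p. p \<in> closure \<Omega> \<times> {0..} \<Longrightarrow> dist p (y, s) < e \<Longrightarrow>
      dist ((\<lambda>(x, t). u x t) p) ((\<lambda>(x, t). u x t) (y, s)) < u y s"
    using cont[unfolded continuous_on_iff, rule_format, of "(y, s)" "u y s"] assms(1,2) by auto
  obtain x0 where x0: "x0 \<in> \<Omega>" "dist x0 y < e / 2"
    using assms(1) e(1) unfolding closure_approachable by (metis half_gt_zero)
  define t0 where "t0 = s + e / 4"
  have t0: "0 < t0" using e(1) assms(2) by (simp add: t0_def)
  have "dist (x0, t0) (y, s) < e"
    unfolding dist_Pair_Pair using x0(2) e(1)
    by (intro sqrt_sum_squares_half_less) (auto simp: t0_def dist_real_def)
  with e(2)[of "(x0, t0)"] have "dist (u x0 t0) (u y s) < u y s"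
    using t0 x0(1) in_closure by simp
  then have pos0: "0 < u x0 t0" by (simp add: dist_real_def)
  have inside: "0 < u x t" if "x \<in> \<Omega>" "t0 < t" for x t
  proof (rule strong_positivity[where d = u, OF _ _ _ _ _ x0(1) pos0 that])
    show "open \<Omega>" "connected \<Omega>" using domain by (auto simp: bounded_domain_def)
    show "continuous_on (\<Omega> \<times> {t0..}) (\<lambda>(x, t). u x t)"
      by (rule continuous_on_subset[OF cont]) (use t0 in_closure in auto)
    show "0 \<le> u x t" if "x \<in> \<Omega>" "t0 \<le> t" for x t
      using nonneg in_closure that t0 by auto
    show "supersol_at u x t" if "x \<in> \<Omega>" "t0 < t" for x t
    proof -
      have "0 \<le> \<alpha> t * f (u x t)"
        using that t0 in_closure nonneg \<alpha>_nonneg f_nonneg by auto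
      moreover have "0 < t" using that t0 by simp
      ultimately show ?thesis
        unfolding supersol_at_def using twice_diff[OF that(1), of t] equation[OF that(1), of t]
        by (auto intro!: exI[of _ "laplacian (\<lambda>y. u y t) x + \<alpha> t * f (u x t)"])
    qed
  qed
  \<comment> \<open>Interior positivity holds strictly after \<open>t0\<close>; starting at
    \<open>t0 + 1\<close> gives Hopf's lemma a closed time interval on which it is
    available.\<close>
  have "0 < u x (t0 + 2)" if "x \<in> closure \<Omega>" for x
  proof (cases "x \<in> \<Omega>")
    case False
    have "open \<Omega>" using domain by (simp add: bounded_domain_def)
    then have fr: "x \<in> frontier \<Omega>" using that False by (simp add: frontier_def interior_open)
    show ?thesis
    proof (rule boundary_positivity[where a = "t0 + 1" and z = "\<lambda>_. 0" and z' = "\<lambda>_. 0" and ?r0.0 = 1, OF _ _ _ _ _ fr])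
      show "0 \<le> \<alpha> t * f (u y t)" if "y \<in> \<Omega>" "y \<in> ball x 1" "t \<in> {t0 + 1<..t0 + 2}" for y t
        using that t0 in_closure nonneg \<alpha>_nonneg f_nonneg by auto
      show "0 \<le> t0 + 1" "t0 + 1 < t0 + 2" "0 < (1::real)" using t0 by simp_all
      show "((\<lambda>_. 0) has_real_derivative 0) (at t)" for t :: real by simp
      show "0 \<le> u y t" if "y \<in> closure \<Omega>" "t \<in> {t0 + 1..t0 + 2}" for y t
        using that t0 by (intro nonneg) simp_all
      show "0 < u y t" if "y \<in> \<Omega>" "t \<in> {t0 + 1..t0 + 2}" for y t
        using that by (intro inside) simp_all
    qed
  qed (use inside in auto)
  then show ?thesis using that[of "t0 + 2"] t0 by simp
qed

text \<open>A first contact is excluded. Inside \<Omega> it contradicts the equation, where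
  \<open>u = z\<close> makes the reaction terms equal; on the boundary it contradicts
  \<open>boundary_positivity\<close>.\<close>

lemma comparison:
  assumes ab: "0 \<le> a" and init: "\<And>x. x \<in> closure \<Omega> \<Longrightarrow> z a < u x a"
    and z: "\<And>t. t \<in> {a..b} \<Longrightarrow> (z has_real_derivative z' t) (at t)"
    and z_nonneg: "\<And>t. t \<in> {a..b} \<Longrightarrow> 0 \<le> z t"
    and cont_z': "continuous_on {a..b} z'"
    and z': "\<And>t. t \<in> {a<..b} \<Longrightarrow> z' t < \<alpha> t * f (z t)"
    and "x \<in> closure \<Omega>" "t \<in> {a..b}"
  shows "z t < u x t"
proof (rule ccontr)
  assume neg: "\<not> z t < u x t"
  have cont_z: "continuous_on {a..b} z"
    by (intro continuous_at_imp_continuous_on ballI DERIV_isCont[OF z])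
  \<comment> \<open>The contact set. It is compact, so the time coordinate attains its minimum on
    it, which is the first contact time.\<close>
  define C where "C = {p \<in> closure \<Omega> \<times> {a..b}. u (fst p) (snd p) - z (snd p) \<le> 0}"
  have cont_u: "continuous_on (closure \<Omega> \<times> {a..b}) (\<lambda>p. u (fst p) (snd p))"
    using cont ab by (auto simp: case_prod_unfold elim!: continuous_on_subset)
  have "compact C" unfolding C_def
    by (intro compact_sublevel compact_Times compact_closed_domain continuous_on_diff cont_u
        continuous_on_compose2[OF cont_z]) (auto intro!: continuous_intros)
  moreover have "(x, t) \<in> C" using neg assms(7,8) by (simp add: C_def)
  then have "C \<noteq> {}" by blast
  ultimately obtain p where p: "p \<in> C" "\<And>q. q \<in> C \<Longrightarrow> snd p \<le> snd q"
    using continuous_attains_inf[of C snd] continuous_on_snd[OF continuous_on_id] by blast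
  obtain x1 t1 where xt: "p = (x1, t1)" by (cases p)
  have x1: "x1 \<in> closure \<Omega>" and t1: "t1 \<in> {a..b}" and touch: "u x1 t1 \<le> z t1"
    using p(1) by (auto simp: C_def xt)
  have at1: "a < t1" using init[OF x1] touch t1 by (cases "t1 = a") auto
  have before: "z s < u y s" if "y \<in> closure \<Omega>" "s \<in> {a..<t1}" for y s
  proof (rule ccontr)
    assume "\<not> z s < u y s"
    then have "(y, s) \<in> C" using that t1 by (simp add: C_def)
    then show False using p(2)[of "(y, s)"] that by (simp add: xt)
  qed
  have le: "z s \<le> u y s" if "y \<in> closure \<Omega>" "s \<in> {a..t1}" for y s
  proof -
    have cl: "closure {a..<t1} = {a..t1}" using at1 by simp
    have "0 \<le> u y s - z s"
    proof (rule continuous_ge_on_closure[of "{a..<t1}" "\<lambda>s. u y s - z s"])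
      show "continuous_on (closure {a..<t1}) (\<lambda>s. u y s - z s)"
        unfolding cl
        by (intro continuous_on_diff continuous_on_subset[OF cont_time[OF that(1)]]
            continuous_on_subset[OF cont_z]) (use ab t1 in auto)
    qed (use before[OF that(1)] that(2) cl in \<open>auto intro: less_imp_le\<close>)
    then show ?thesis by simp
  qed
  \<comment> \<open>At an interior contact \<open>u\<close> has a spatial minimum and
    \<open>u - z\<close> a minimum from the left in time, which forces
    \<open>\<alpha> t1 * f (z t1) \<le> z' t1\<close>.\<close>
  have inside: "z t1 < u y t1" if "y \<in> \<Omega>" for y
  proof (rule ccontr)
    assume "\<not> z t1 < u y t1"
    then have eq: "u y t1 = z t1" using le[of y t1] in_closure[OF that] at1 by auto
    have t1pos: "0 < t1" using ab at1 by simp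
    have "\<forall>\<^sub>F w in nhds y. w \<in> \<Omega>"
      using domain that by (intro eventually_nhds_in_open) (auto simp: bounded_domain_def)
    then have "\<forall>\<^sub>F w in nhds y. u y t1 \<le> u w t1"
      by eventually_elim (use le[of _ t1] in_closure at1 eq in auto)
    then have lap: "0 \<le> laplacian (\<lambda>y. u y t1) y"
      by (rule laplacian_nonneg_at_min[OF twice_diff[OF that t1pos]])
    have "((\<lambda>s. u y s - z s) has_real_derivative
        laplacian (\<lambda>y. u y t1) y + \<alpha> t1 * f (u y t1) - z' t1) (at_left t1)"
      by (rule has_field_derivative_at_within[OF DERIV_diff[OF equation[OF that t1pos] z[OF t1]]])
    moreover have "\<forall>\<^sub>F s in at_left t1. u y t1 - z t1 \<le> u y s - z s"
      using at1 le in_closure[OF that] by (intro eventually_at_leftI[of a]) (auto simp: eq)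
    ultimately have "laplacian (\<lambda>y. u y t1) y + \<alpha> t1 * f (u y t1) - z' t1 \<le> 0"
      by (rule left_derivative_nonpos_at_min)
    then show False using lap z'[of t1] t1 at1 by (simp add: eq)
  qed
  have "open \<Omega>" using domain by (simp add: bounded_domain_def)
  then have fr: "x1 \<in> frontier \<Omega>" using x1 inside[of x1] touch by (auto simp: frontier_def interior_open)
  have eq: "u x1 t1 = z t1" using le[OF x1, of t1] touch at1 by simp
  \<comment> \<open>The strict inequality at the contact point persists near it by continuity of
    \<open>E\<close>. This takes the place of a Lipschitz bound on \<open>f\<close> in comparing
    \<open>f u\<close> with \<open>f z\<close>.\<close>
  define E where "E = (\<lambda>p. \<alpha> (snd p) * f (u (fst p) (snd p)) - z' (snd p))"
  have cont_E: "continuous_on (closure \<Omega> \<times> {a..b}) E"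
    unfolding E_def
    by (intro continuous_on_diff continuous_on_mult continuous_on_compose2[OF cont_f cont_u]
        continuous_on_compose2[OF cont_z'] continuous_on_compose2[OF cont_\<alpha>])
      (use ab nonneg in \<open>auto intro!: continuous_intros\<close>)
  have E_pos: "E (x1, t1) > 0" using z'[of t1] at1 t1 by (simp add: E_def eq)
  have "(x1, t1) \<in> closure \<Omega> \<times> {a..b}" using x1 t1 by simp
  then obtain e where e: "e > 0"
    "\<And>p. p \<in> closure \<Omega> \<times> {a..b} \<Longrightarrow> dist p (x1, t1) < e \<Longrightarrow> dist (E p) (E (x1, t1)) < E (x1, t1)"
    using cont_E[unfolded continuous_on_iff, rule_format, OF _ E_pos] by blast
  \<comment> \<open>A late enough start keeps the part of space-time used by Hopf's lemma within
    distance \<open>e\<close> of the contact point, where \<open>E\<close> is positive.\<close>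
  define c where "c = max a (t1 - e / 2)"
  have c: "a \<le> c" "c < t1" "t1 - e / 2 \<le> c" using at1 e(1) by (auto simp: c_def)
  have "z t1 < u x1 t1"
  proof (rule boundary_positivity[where a = c and z = z and z' = z' and ?r0.0 = "e / 2", OF _ c(2) _ _ _ fr])
    show "z' s \<le> \<alpha> s * f (u y s)" if "y \<in> \<Omega>" "y \<in> ball x1 (e / 2)" "s \<in> {c<..t1}" for y s
    proof -
      have "dist (y, s) (x1, t1) < e"
        unfolding dist_Pair_Pair using that c
        by (intro sqrt_sum_squares_half_less) (auto simp: dist_real_def dist_commute)
      then have "dist (E (y, s)) (E (x1, t1)) < E (x1, t1)"
        using that c t1 in_closure by (intro e(2)) auto
      then show ?thesis by (simp add: dist_real_def E_def)
    qed
    show "z s < u y s" if "y \<in> \<Omega>" "s \<in> {c..t1}" for y s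
      using that inside[of y] before[of y s] in_closure c by (cases "s = t1") auto
    show "0 \<le> c" "0 < e / 2" using ab c e(1) by auto
    show "(z has_real_derivative z' s) (at s)" if "s \<in> {c..t1}" for s
      using that c t1 by (intro z) simp
    show "z s \<le> u y s" if "y \<in> closure \<Omega>" "s \<in> {c..t1}" for y s
      using that c by (intro le) simp_all
  qed
  then show False using touch by simp
qed

end

section \<open>Blow-up by separation of variables\<close>

lemma has_real_derivative_inverse_function:
  fixes G H :: "real \<Rightarrow> real"
  assumes "open S" "s \<in> S" and G: "\<And>r. r \<in> S \<Longrightarrow> (G has_real_derivative g r) (at r)"
    and "\<And>r. r \<in> S \<Longrightarrow> H (G r) = r" and "g s \<noteq> 0"
  shows "(H has_real_derivative 1 / g s) (at (G s))"
proof -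
  have "(H has_derivative (\<lambda>h. h / g s)) (at (G s))"
  proof (rule has_derivative_inverse_strong[where S = S and f = G and x = s and f' = "\<lambda>h. g s * h"])
    show "continuous_on S G"
      by (intro continuous_at_imp_continuous_on ballI DERIV_isCont[OF G])
    show "(G has_derivative (\<lambda>h. g s * h)) (at s)"
      using G[OF assms(2)] by (simp add: has_field_derivative_def)
    show "(\<lambda>h. g s * h) \<circ> (\<lambda>h. h / g s) = id" using assms(5) by auto
  qed (use assms in auto)
  then show ?thesis by (rule has_derivative_imp_has_field_derivative) simp
qed

context global_solution
begin

text \<open>The subsolution is built backwards from \<open>G (z t) = B t\<close>. Boundedness of
  \<open>G\<close> and unboundedness of \<open>A\<close> let \<open>z\<close> climb past a bound
  \<open>k\<close> for \<open>u\<close> before time \<open>T\<close>, while comparison keeps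
  \<open>z\<close> below \<open>u\<close>.\<close>

lemma no_global_positive_solution:
  assumes f_pos: "\<And>s. 0 < s \<Longrightarrow> 0 < f s"
    and G: "\<And>s. 0 < s \<Longrightarrow> (G has_real_derivative 1 / f s) (at s)"
    and L: "\<And>s. 0 < s \<Longrightarrow> G s \<le> L"
    and A: "\<And>t. (A has_real_derivative \<alpha> (max 0 t)) (at t)"
    and A_unbounded: "\<And>M. \<exists>t. M < A t"
    and t2: "0 \<le> t2" and pos: "\<And>x. x \<in> closure \<Omega> \<Longrightarrow> 0 < u x t2"
  shows False
proof -
  have mono_A: "A s \<le> A t" if "s \<le> t" for s t
  proof (rule DERIV_nonneg_imp_nondecreasing[OF that])
    show "\<exists>D. (A has_real_derivative D) (at r) \<and> 0 \<le> D" for r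
      using A[of r] \<alpha>_nonneg[of "max 0 r"] by auto
  qed
  have mono_G: "G s < G t" if "0 < s" "s < t" for s t
  proof (rule DERIV_pos_imp_increasing[OF that(2)])
    show "\<exists>D. (G has_real_derivative D) (at r) \<and> 0 < D" if "s \<le> r" for r
      using G[of r] f_pos[of r] \<open>0 < s\<close> that by (intro exI[of _ "1 / f r"]) simp
  qed
  have "inj_on G {0<..}"
    by (rule linorder_inj_onI) (use mono_G in \<open>simp_all add: less_imp_neq linear\<close>)
  then have inv: "the_inv_into {0<..} G (G s) = s" if "0 < s" for s
    using that by (simp add: the_inv_into_f_f)
  have ne: "closure \<Omega> \<noteq> {}" using domain by (simp add: bounded_domain_def)
  have "continuous_on (closure \<Omega>) (\<lambda>x. (\<lambda>(x, t). u x t) (x, t2))"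
    by (rule continuous_on_compose2[OF cont]) (use t2 in \<open>auto intro!: continuous_intros\<close>)
  then obtain xm where xm: "xm \<in> closure \<Omega>" "\<And>x. x \<in> closure \<Omega> \<Longrightarrow> u xm t2 \<le> u x t2"
    using continuous_attains_inf[OF compact_closed_domain ne, of "\<lambda>x. u x t2"] by auto
  define c where "c = u xm t2 / 2"
  have c: "0 < c" "\<And>x. x \<in> closure \<Omega> \<Longrightarrow> c < u x t2"
    using pos[OF xm(1)] xm(2) by (force simp: c_def)+
  \<comment> \<open>The summand 1 pays for the total loss \<delta>, which is at most 1, so that
    \<open>B T\<close> still exceeds \<open>L\<close>.\<close>
  obtain T where T: "L - G c + 1 + A t2 < A T" using A_unbounded by blast
  have t2T: "t2 < T" using T L[OF c(1)] mono_A[of T t2] by (cases "T \<le> t2") auto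
  have "bounded ((\<lambda>(x, t). u x t) ` (closure \<Omega> \<times> {t2..T}))"
    by (intro compact_imp_bounded compact_continuous_image continuous_on_subset[OF cont]
        compact_Times compact_closed_domain) (use t2 in auto)
  then obtain k where k: "k > 0" "\<And>x t. x \<in> closure \<Omega> \<Longrightarrow> t \<in> {t2..T} \<Longrightarrow> \<bar>u x t\<bar> \<le> k"
    unfolding bounded_pos by force
  \<comment> \<open>The total loss over \<open>[t2, T]\<close>, spread evenly by \<epsilon>. The
    second bound keeps \<open>B\<close> above \<open>G (c / 2)\<close>, hence \<open>z\<close> above
    \<open>c / 2\<close> and away from the zero of the argument of \<open>1 / f\<close>.\<close>
  define \<delta> where "\<delta> = min 1 (G c - G (c / 2))"
  have \<delta>: "0 < \<delta>" "\<delta> \<le> 1" "\<delta> \<le> G c - G (c / 2)"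
    using mono_G[of "c / 2" c] c(1) by (auto simp: \<delta>_def)
  define \<epsilon> where "\<epsilon> = \<delta> / (T - t2)"
  have \<epsilon>: "0 < \<epsilon>" "\<epsilon> * (T - t2) = \<delta>" using \<delta> t2T by (auto simp: \<epsilon>_def)
  define B where "B = (\<lambda>t. G c + (A t - A t2) - \<epsilon> * (t - t2))"
  have B: "(B has_real_derivative \<alpha> (max 0 t) - \<epsilon>) (at t)" for t
    unfolding B_def by (auto intro!: derivative_eq_intros A)
  have cont_B: "continuous_on S B" for S
    by (intro continuous_at_imp_continuous_on ballI DERIV_isCont[OF B])
  have ck: "c < k + 1" using c(2)[OF xm(1)] k(2)[OF xm(1), of t2] t2T by auto
  have B_t2: "B t2 < G (k + 1)" using mono_G[OF c(1) ck] by (simp add: B_def)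
  have B_T: "G (k + 1) < B T"
    using T L[of "k + 1"] k(1) \<epsilon>(2) \<delta>(2) by (simp add: B_def)
  \<comment> \<open>The first time \<open>t'\<close> at which \<open>B\<close> reaches
    \<open>G (k + 1)\<close>. Up to then \<open>B\<close> stays between two values of
    \<open>G\<close>, so the inverse of \<open>G\<close> is defined along it even though
    \<open>B\<close> may later leave the range of \<open>G\<close>.\<close>
  have "compact {t \<in> {t2..T}. G (k + 1) - B t \<le> 0}"
    by (intro compact_sublevel continuous_intros cont_B) auto
  moreover have "T \<in> {t \<in> {t2..T}. G (k + 1) - B t \<le> 0}" using B_T t2T by simp
  ultimately obtain t' where t': "t' \<in> {t2..T}" "G (k + 1) \<le> B t'"
    and first: "\<And>t. t \<in> {t2..T} \<Longrightarrow> G (k + 1) \<le> B t \<Longrightarrow> t' \<le> t"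
    using compact_attains_inf[of "{t \<in> {t2..T}. G (k + 1) - B t \<le> 0}"] by auto
  have t2t': "t2 < t'" using t' B_t2 by (cases "t' = t2") auto
  have B_le: "B t \<le> G (k + 1)" if "t \<in> {t2..t'}" for t
  proof (rule continuous_le_on_closure[of "{t2..<t'}" B])
    show "B t \<le> G (k + 1)" if "t \<in> {t2..<t'}" for t
      using first[of t] that t' by force
  qed (use that t2t' cont_B in auto)
  have B_ge: "G (c / 2) \<le> B t" if "t \<in> {t2..t'}" for t
  proof -
    have "\<epsilon> * (t - t2) \<le> \<epsilon> * (T - t2)" using that t' \<epsilon>(1) by (intro mult_left_mono) auto
    then show ?thesis using mono_A[of t2 t] that \<epsilon>(2) \<delta>(3) by (simp add: B_def)
  qed
  define z where "z = (\<lambda>t. the_inv_into {0<..} G (B t))"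
  have z: "c / 2 \<le> z t" "G (z t) = B t" if "t \<in> {t2..t'}" for t
  proof -
    have "\<exists>s. c / 2 \<le> s \<and> s \<le> k + 1 \<and> G s = B t"
    proof (rule IVT')
      show "continuous_on {c / 2..k + 1} G"
        using G c(1) by (intro continuous_at_imp_continuous_on ballI DERIV_isCont[OF G]) auto
    qed (use B_ge[OF that] B_le[OF that] ck c(1) in auto)
    then obtain s where "c / 2 \<le> s" "G s = B t" by blast
    moreover from this have "z t = s" using inv[of s] c(1) by (simp add: z_def)
    ultimately show "c / 2 \<le> z t" "G (z t) = B t" by auto
  qed
  have z_pos: "0 < z t" if "t \<in> {t2..t'}" for t using z(1)[OF that] c(1) by linarith
  \<comment> \<open>Differentiating \<open>G (z t) = B t\<close> gives this formula; it falls short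
    of the reaction term by \<open>\<epsilon> * f (z t) > 0\<close>.\<close>
  define z' where "z' = (\<lambda>t. f (z t) * (\<alpha> (max 0 t) - \<epsilon>))"
  have Dz: "(z has_real_derivative z' t) (at t)" if "t \<in> {t2..t'}" for t
  proof -
    have "(the_inv_into {0<..} G has_real_derivative 1 / (1 / f (z t))) (at (G (z t)))"
      by (rule has_real_derivative_inverse_function[of "{0<..}"])
        (use z_pos[OF that] f_pos[of "z t"] G inv in auto)
    then have "(the_inv_into {0<..} G has_real_derivative f (z t)) (at (B t))"
      by (simp add: z(2)[OF that])
    from DERIV_chain2[OF this B] show ?thesis by (simp add: z_def z'_def)
  qed
  have "z t' < u xm t'"
  proof (rule comparison[of t2 z t' z'])
    have "z t2 = c" using inv[OF c(1)] by (simp add: z_def B_def)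
    then show "z t2 < u x t2" if "x \<in> closure \<Omega>" for x using c(2)[OF that] by simp
    have "continuous_on {t2..t'} z"
      by (intro continuous_at_imp_continuous_on ballI DERIV_isCont[OF Dz])
    then show "continuous_on {t2..t'} z'"
      unfolding z'_def
      by (intro continuous_intros continuous_on_compose2[OF cont_f] continuous_on_compose2[OF cont_\<alpha>])
        (use z_pos in \<open>auto intro: less_imp_le\<close>)
    show "z' t < \<alpha> t * f (z t)" if "t \<in> {t2<..t'}" for t
    proof -
      have "0 < \<epsilon> * f (z t)" using f_pos z_pos[of t] that \<epsilon>(1) by simp
      then show ?thesis using that t2 by (simp add: z'_def algebra_simps)
    qed
  qed (use t2 Dz z_pos t2t' xm(1) in \<open>auto intro: less_imp_le\<close>)
  moreover have "z t' = k + 1"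
  proof -
    have "B t' = G (k + 1)" using B_le[of t'] t' t2t' by auto
    then show ?thesis using inv[of "k + 1"] k(1) by (simp add: z_def)
  qed
  ultimately show False using k(2)[OF xm(1) t'(1)] by simp
qed

end

section \<open>The two integral conditions\<close>

text \<open>A bounded monotone antiderivative has a limit, and the fundamental theorem of calculus
  would make the integral finite. Freezing the argument at 0 for negative times extends \<alpha>
  continuously, so \<open>A\<close> is differentiable on the whole line.\<close>

lemma nn_integral_infinite_imp_unbounded:
  assumes \<alpha>: "continuous_on {0..} \<alpha>" "\<And>t. 0 \<le> t \<Longrightarrow> 0 \<le> \<alpha> t"
    and inf: "(\<integral>\<^sup>+ t\<in>{0..}. ennreal (\<alpha> t) \<partial>lborel) = \<infinity>"
  obtains A where "\<And>t. (A has_real_derivative \<alpha> (max 0 t)) (at t)" "\<And>M. \<exists>t. M < A t"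
proof -
  have cont: "continuous_on UNIV (\<lambda>t. \<alpha> (max 0 t))"
    by (rule continuous_on_compose2[OF \<alpha>(1)]) (auto intro!: continuous_intros)
  have "\<exists>A. \<forall>x::real. -\<infinity> < ereal x \<longrightarrow> ereal x < \<infinity> \<longrightarrow>
      (A has_vector_derivative \<alpha> (max 0 x)) (at x)"
    using cont by (intro einterval_antiderivative) (auto simp: continuous_on_eq_continuous_at)
  then obtain A where A: "\<And>t. (A has_real_derivative \<alpha> (max 0 t)) (at t)"
    by (auto simp: has_real_derivative_iff_has_vector_derivative)
  have mono: "A s \<le> A t" if "s \<le> t" for s t
  proof (rule DERIV_nonneg_imp_nondecreasing[OF that])
    show "\<exists>D. (A has_real_derivative D) (at r) \<and> 0 \<le> D" for r
      using A[of r] \<alpha>(2)[of "max 0 r"] by auto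
  qed
  have "\<exists>t. M < A t" for M
  proof (rule ccontr)
    assume "\<not> (\<exists>t. M < A t)"
    then have bdd: "bdd_above (range A)" by (auto simp: not_less bdd_above_def)
    have lim: "(A \<longlongrightarrow> (SUP t. A t)) at_top"
    proof (rule increasing_tendsto)
      show "\<forall>\<^sub>F t in at_top. A t \<le> (SUP t. A t)" using bdd by (simp add: cSUP_upper)
      fix y assume "y < (SUP t. A t)"
      then obtain s where "y < A s" using bdd by (auto simp: less_cSUP_iff)
      then show "\<forall>\<^sub>F t in at_top. y < A t"
        using mono unfolding eventually_at_top_linorder by (meson less_le_trans)
    qed
    have "(\<integral>\<^sup>+ t. ennreal (\<alpha> (max 0 t)) * indicator {0..} t \<partial>lborel) = (SUP t. A t) - A 0"
      by (rule nn_integral_FTC_atLeast[OF borel_measurable_continuous_onI[OF cont] A _ lim])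
        (simp add: \<alpha>(2))
    also have "(\<integral>\<^sup>+ t. ennreal (\<alpha> (max 0 t)) * indicator {0..} t \<partial>lborel) =
        (\<integral>\<^sup>+ t\<in>{0..}. ennreal (\<alpha> t) \<partial>lborel)"
      by (intro nn_integral_cong) (auto split: split_indicator)
    finally show False using inf by simp
  qed
  with A show ?thesis by (rule that)
qed

text \<open>Beyond \<open>a\<close> the increase of \<open>G\<close> is at most the finite integral;
  below \<open>a\<close> monotonicity gives the same bound. Only an upper bound is claimed, as
  \<open>G\<close> may tend to minus infinity at 0.\<close>

lemma nn_integral_finite_imp_bounded:
  assumes f: "continuous_on {0..} f" "\<And>s. 0 < s \<Longrightarrow> 0 < f s"
    and a: "0 < a" and fin: "(\<integral>\<^sup>+ s\<in>{a..}. ennreal (1 / f s) \<partial>lborel) < \<infinity>"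
  obtains G L where "\<And>s. 0 < s \<Longrightarrow> (G has_real_derivative 1 / f s) (at s)"
    "\<And>s. 0 < s \<Longrightarrow> G s \<le> L"
proof -
  have "isCont (\<lambda>s. 1 / f s) x" if "0 < x" for x
  proof -
    have "continuous_on {0<..} (\<lambda>s. 1 / f s)"
      by (intro continuous_on_divide continuous_on_const continuous_on_subset[OF f(1)])
        (use f(2) in \<open>simp_all add: less_imp_neq[THEN not_sym] subset_iff\<close>)
    then show ?thesis using that by (simp add: continuous_on_eq_continuous_at)
  qed
  then have "\<exists>G. \<forall>x::real. 0 < ereal x \<longrightarrow> ereal x < \<infinity> \<longrightarrow>
      (G has_vector_derivative 1 / f x) (at x)"
    by (intro einterval_antiderivative) auto
  then obtain G where G: "\<And>s. 0 < s \<Longrightarrow> (G has_real_derivative 1 / f s) (at s)"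
    by (auto simp: has_real_derivative_iff_has_vector_derivative)
  have mono: "G s \<le> G t" if "0 < s" "s \<le> t" for s t
  proof (rule DERIV_nonneg_imp_nondecreasing[OF that(2)])
    show "\<exists>D. (G has_real_derivative D) (at r) \<and> 0 \<le> D" if "s \<le> r" for r
      using G[of r] f(2)[of r] \<open>0 < s\<close> that by (intro exI[of _ "1 / f r"]) simp
  qed
  define I where "I = (\<integral>\<^sup>+ s\<in>{a..}. ennreal (1 / f s) \<partial>lborel)"
  have pos: "0 < f (max a s)" for s using f(2) a by simp
  \<comment> \<open>Replacing \<open>s\<close> by \<open>max a s\<close> leaves the integrand
    unchanged on the range of integration and makes it continuous, hence measurable, on the whole
    line.\<close>
  have cont: "continuous_on UNIV (\<lambda>s. 1 / f (max a s))"
    by (intro continuous_on_divide continuous_on_const continuous_on_compose2[OF f(1)])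
      (use a pos in \<open>auto simp: less_imp_neq[THEN not_sym] intro!: continuous_intros\<close>)
  have bound: "G s \<le> G a + enn2real I" if "a \<le> s" for s
  proof -
    have "ennreal (G s - G a) = (\<integral>\<^sup>+ r. ennreal (1 / f (max a r)) * indicator {a..s} r \<partial>lborel)"
    proof (rule nn_integral_FTC_Icc[OF borel_measurable_continuous_onI[OF cont] _ _ that, symmetric])
      show "(G has_real_derivative 1 / f (max a r)) (at r)" if "r \<in> {a..s}" for r
        using G[of r] a that by (simp add: max_absorb2)
      show "0 \<le> 1 / f (max a r)" for r using less_imp_le[OF pos] by simp
    qed
    also have "\<dots> \<le> I" unfolding I_def
      by (intro nn_integral_mono) (auto split: split_indicator)
    finally have "ennreal (G s - G a) \<le> ennreal (enn2real I)" using fin by (simp add: I_def)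
    then show ?thesis by (simp add: ennreal_le_iff)
  qed
  have "G s \<le> G a + enn2real I" if "0 < s" for s
    using bound[of "max a s"] mono[of s "max a s"] that by simp
  with G show ?thesis by (rule that)
qed

section \<open>From classical solutions on all finite cylinders to the theorem\<close>

lemma global_solution_if_classical:
  fixes \<Omega> :: "'a::euclidean_space set"
  assumes "bounded_domain \<Omega>" "unit_exterior_normal \<Omega> \<nu>"
    and "continuous_on {0..} f" "\<And>s. s \<ge> 0 \<Longrightarrow> f s \<ge> 0" "\<And>s. s \<ge> 0 \<Longrightarrow> g s \<ge> 0"
    and "continuous_on {0..} \<alpha>" "\<And>t. t \<ge> 0 \<Longrightarrow> \<alpha> t \<ge> 0" "\<And>t. t \<ge> 0 \<Longrightarrow> \<beta> t \<ge> 0"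
    and sol: "\<And>T. T > 0 \<Longrightarrow> nonneg_classical_solution \<Omega> \<nu> f g \<alpha> \<beta> u\<^sub>0 T u"
  shows "global_solution \<Omega> \<nu> \<alpha> f u"
proof
  show nonneg: "0 \<le> u x t" if "x \<in> closure \<Omega>" "0 \<le> t" for x t
    using sol[of "t + 1"] that by (auto simp: nonneg_classical_solution_def)
  show "continuous_on (closure \<Omega> \<times> {0..}) (\<lambda>(x, t). u x t)"
    unfolding continuous_on_eq_continuous_within
  proof
    fix p :: "'a \<times> real" assume p: "p \<in> closure \<Omega> \<times> {0..}"
    \<comment> \<open>Continuity is local in time: each point lies strictly below the top of a
      cylinder of height \<open>T\<close>, and there both cylinders have the same neighbourhood
      filter.\<close>
    define T where "T = snd p + 1"
    have "continuous_on (closure \<Omega> \<times> {0..<T}) (\<lambda>(x, t). u x t)"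
      using sol[of T] p
      by (auto simp: nonneg_classical_solution_def C10_up_to_parabolic_boundary_def T_def)
    then have "continuous (at p within closure \<Omega> \<times> {0..<T}) (\<lambda>(x, t). u x t)"
      using p unfolding continuous_on_eq_continuous_within by (auto simp: T_def)
    moreover have "at p within closure \<Omega> \<times> {0..} = at p within closure \<Omega> \<times> {0..<T}"
      by (rule at_within_nhd[of p "UNIV \<times> {..<T}"])
        (use p in \<open>auto simp: T_def intro: open_Times\<close>)
    ultimately show "continuous (at p within closure \<Omega> \<times> {0..}) (\<lambda>(x, t). u x t)" by simp
  qed
  fix x t assume t: "(0::real) < t"
  have S: "nonneg_classical_solution \<Omega> \<nu> f g \<alpha> \<beta> u\<^sub>0 (t + 1) u" using sol t by simp
  show "twice_diff_at (\<lambda>y. u y t) x" if "x \<in> \<Omega>"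
    using S t that assms(1) twice_diff_at_if_Ck_on[of \<Omega>]
    by (auto simp: nonneg_classical_solution_def C21_cylinder_def bounded_domain_def)
  show "(u x has_real_derivative laplacian (\<lambda>y. u y t) x + \<alpha> t * f (u x t)) (at t)" if "x \<in> \<Omega>"
  proof -
    have "u x differentiable at t" "deriv (u x) t = laplacian (\<lambda>y. u y t) x + \<alpha> t * f (u x t)"
      using S t that by (auto simp: nonneg_classical_solution_def C21_cylinder_def)
    then show ?thesis using DERIV_deriv_iff_real_differentiable by metis
  qed
  show "\<exists>D\<ge>0. has_normal_derivative (\<lambda>y. u y t) D \<nu> x" if "x \<in> frontier \<Omega>"
  proof -
    have "0 \<le> \<beta> t * g (u x t)"
      using assms(5,8) nonneg[of x t] t that by (auto simp: frontier_def)
    moreover have "has_normal_derivative (\<lambda>y. u y t) (\<beta> t * g (u x t)) \<nu> x"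
      using S t that by (auto simp: nonneg_classical_solution_def)
    ultimately show ?thesis by blast
  qed
qed (use assms in auto)

theorem theorem2p6:
  fixes \<Omega> :: "'a::euclidean_space set"
    and \<nu> :: "'a \<Rightarrow> 'a"
    and f g \<alpha> \<beta> :: "real \<Rightarrow> real"
    and u\<^sub>0 :: "'a \<Rightarrow> real"
  assumes "bounded_domain \<Omega>"
    and "smooth_boundary \<Omega>"
    and "unit_exterior_normal \<Omega> \<nu>"
    and "continuous_on {0..} f" and "\<And>s. s \<ge> 0 \<Longrightarrow> f s \<ge> 0"
    and "continuous_on {0..} g" and "\<And>s. s \<ge> 0 \<Longrightarrow> g s \<ge> 0"
    and "continuous_on {0..} \<alpha>" and "\<And>t. t \<ge> 0 \<Longrightarrow> \<alpha> t \<ge> 0"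
    and "continuous_on {0..} \<beta>" and "\<And>t. t \<ge> 0 \<Longrightarrow> \<beta> t \<ge> 0"
    and "C1_closure \<Omega> u\<^sub>0" and "\<And>x. x \<in> closure \<Omega> \<Longrightarrow> u\<^sub>0 x \<ge> 0"
    and "\<And>x. x \<in> frontier \<Omega> \<Longrightarrow> has_normal_derivative u\<^sub>0 (\<beta> 0 * g (u\<^sub>0 x)) \<nu> x"
    and "\<And>s. s > 0 \<Longrightarrow> f s > 0"
    and "\<exists>a>0. (\<integral>\<^sup>+ s\<in>{a..}. ennreal (1 / f s) \<partial>lborel) < \<infinity>"
    and "(\<integral>\<^sup>+ t\<in>{0..}. ennreal (\<alpha> t) \<partial>lborel) = \<infinity>"
  shows "\<not> (\<exists>u. (\<forall>T>0. nonneg_classical_solution \<Omega> \<nu> f g \<alpha> \<beta> u\<^sub>0 T u) \<and>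
               (\<exists>x\<in>closure \<Omega>. \<exists>t\<ge>0. u x t \<noteq> 0))"
proof
  assume "\<exists>u. (\<forall>T>0. nonneg_classical_solution \<Omega> \<nu> f g \<alpha> \<beta> u\<^sub>0 T u) \<and>
    (\<exists>x\<in>closure \<Omega>. \<exists>t\<ge>0. u x t \<noteq> 0)"
  then obtain u y s where sol: "\<And>T. T > 0 \<Longrightarrow> nonneg_classical_solution \<Omega> \<nu> f g \<alpha> \<beta> u\<^sub>0 T u"
    and ys: "y \<in> closure \<Omega>" "0 \<le> s" "u y s \<noteq> 0"
    by blast
  interpret global_solution \<Omega> \<nu> \<alpha> f u
    using global_solution_if_classical[OF assms(1,3,4,5,7,8,9,11) sol] .
  obtain t where "0 < t" "\<And>x. x \<in> closure \<Omega> \<Longrightarrow> 0 < u x t"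
    using eventually_positive[OF ys] by blast
  moreover obtain A where "\<And>t. (A has_real_derivative \<alpha> (max 0 t)) (at t)" "\<And>M. \<exists>t. M < A t"
    using nn_integral_infinite_imp_unbounded[OF assms(8,9,17)] by blast
  moreover obtain a where a: "0 < a" "(\<integral>\<^sup>+ s\<in>{a..}. ennreal (1 / f s) \<partial>lborel) < \<infinity>"
    using assms(16) by blast
  obtain G L where "\<And>s. 0 < s \<Longrightarrow> (G has_real_derivative 1 / f s) (at s)"
    "\<And>s. 0 < s \<Longrightarrow> G s \<le> L"
    using nn_integral_finite_imp_bounded[OF assms(4,15) a] by blast
  ultimately show False
    using no_global_positive_solution[OF assms(15), of G L A t] by simp
qed

end
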